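(* Let $m>1$ be an integer, let $F_m$ be the free group of rank $m$ with free generating set $A=\{x_1,\dots,x_m\}$, let $R$ be a normal subgroup of $F_m$, let $R'=[R,R]$ be its commutator subgroup, and let $\rho$ be a positive integer. Assume that the following three conditions hold: 1) the group $F_m/R$ has exactly one end; 2) there are no nonempty positive words in $R$; 3) any nonempty cyclically reduced word in $R$ has length at least $\rho$. Then the group $G=F_m/R'$ has strict dead end elements of depth $\lfloor \rho/2\rfloor-1$ with respect to the generating set given by the images of $x_1,\dots,x_m$; that is, there exists at least one element $g\in G$ which is a strict dead end of depth $\lfloor \rho/2\rfloor-1$.
   Context: For a group $G$ generated by a finite set $A$, the right Cayley graph $\mathcal{C}(G,A)$ has vertex set $G$ and edge set $G\times A^{\pm1}$; the edge $(g,a)$ goes from $g$ to $ga$, is labelled by $a$, and has inverse edge $(ga,a^{-1})$. For $g\in G$, $|g|$ denotes the distance in this graph from $g$ to the identity (the word length of $g$ with respect to $A$). An element $g\in G$ is a strict dead end of depth $k$ (with respect to $A$) if $|g|>|ga_1|>|ga_1a_2|>\cdots>|ga_1a_2\cdots a_k|$ for all $a_1,\dots,a_k\in A^{\pm1}$ such that the word $a_1a_2\cdots a_k$ is freely irreducible (i.e. freely reduced: no letter is immediately followed by its formal inverse; the letters are regarded as formal symbols $x_i^{\pm1}$). For $k\le 0$ the condition is regarded as vacuous. For the quotients $F_m/R$ and $F_m/R'$ the generating set is the one induced by the standard generators $x_1,\dots,x_m$. A group word in the alphabet $\{x_1,\dots,x_m\}$ is positive if it contains no letters of the form $x_i^{-1}$.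 A word is said to be in $R$ if the element of $F_m$ it represents lies in $R$. Number of ends: for a finitely generated group $H$ with Cayley graph $\mathcal{C}$ with respect to a finite generating set, let $B_n$ be the ball of radius $n$ around the identity. The number of ends of $H$ is the limit as $n\to\infty$ of the number of infinite connected components of $\mathcal{C}-B_n$ (the graph obtained by deleting all vertices at distance $\le n$ from the identity and all edges incident to them). It is independent of the finite generating set. *)

theory Defs
  imports
    "HOL-Algebra.Algebra"
    "HOL-Library.Extended_Real"
    "Graph_Theory.Graph_Theory"
begin

section \<open>Words and free groups\<close>

text \<open>
  The letters over \<open>m\<close> generators are formal symbols: \<open>(i, True)\<close> stands for the \<open>i\<close>-th
  generator and \<open>(i, False)\<close> for its formal inverse, where \<open>i < m\<close> (so the generators
  are numbered from 0).
\<close>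

type_synonym letter = "nat \<times> bool"
type_synonym word = "letter list"

definition letters :: "nat \<Rightarrow> letter set" where
  "letters m = {..<m} \<times> UNIV"

definition inv_letter :: "letter \<Rightarrow> letter" where
  "inv_letter a = (fst a, \<not> snd a)"

definition freely_reduced :: "word \<Rightarrow> bool" where
  "freely_reduced w \<longleftrightarrow> successively (\<lambda>a b. b \<noteq> inv_letter a) w"

definition cyclically_reduced :: "word \<Rightarrow> bool" where
  "cyclically_reduced w \<longleftrightarrow>
     freely_reduced w \<and> (w \<noteq> [] \<longrightarrow> hd w \<noteq> inv_letter (last w))"

definition positive_word :: "word \<Rightarrow> bool" where
  "positive_word w \<longleftrightarrow> (\<forall>a \<in> set w. snd a)"

fun cons_cancel :: "letter \<Rightarrow> word \<Rightarrow> word" where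
  "cons_cancel a [] = [a]"
| "cons_cancel a (b # w) = (if b = inv_letter a then w else a # b # w)"

definition free_reduce :: "word \<Rightarrow> word" where
  "free_reduce w = foldr cons_cancel w []"

text \<open>
  The free group of rank \<open>m\<close>, realised on the freely reduced words. The element represented by
  an arbitrary word \<open>w\<close> is \<open>free_reduce w\<close>.
\<close>

definition free_group :: "nat \<Rightarrow> word monoid" where
  "free_group m =
     \<lparr>carrier = {w \<in> lists (letters m). freely_reduced w},
      monoid.mult = (\<lambda>u v. free_reduce (u @ v)),
      one = []\<rparr>"

definition free_gen :: "nat \<Rightarrow> word" where
  "free_gen i = [(i, True)]"

lemma inv_letter_inv_letter [simp]: "inv_letter (inv_letter a) = a"
  by (simp add: inv_letter_def)

lemma inv_letter_in_letters [simp]: "inv_letter a \<in> letters m \<longleftrightarrow> a \<in> letters m"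
  by (cases a) (simp add: inv_letter_def letters_def)

lemma freely_reduced_Nil [simp]: "freely_reduced []"
  by (simp add: freely_reduced_def)

lemma freely_reduced_cons_cancel: "freely_reduced w \<Longrightarrow> freely_reduced (cons_cancel a w)"
  by (cases w) (auto simp: freely_reduced_def successively_Cons)

lemma freely_reduced_free_reduce: "freely_reduced (free_reduce w)"
  by (induction w)
    (auto simp: free_reduce_def freely_reduced_cons_cancel)

lemma free_reduce_Cons: "free_reduce (a # w) = cons_cancel a (free_reduce w)"
  by (simp add: free_reduce_def)

lemma free_reduce_id: "freely_reduced w \<Longrightarrow> free_reduce w = w"
proof (induction w)
  case Nil
  show ?case by (simp add: free_reduce_def)
next
  case (Cons a w)
  then have "free_reduce w = w"
    by (auto simp: freely_reduced_def successively_Cons)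
  with Cons.prems show ?case
    by (cases w) (auto simp: free_reduce_Cons freely_reduced_def)
qed

lemma cons_cancel_inv_letter:
  "freely_reduced w \<Longrightarrow> cons_cancel a (cons_cancel (inv_letter a) w) = w"
proof (cases w)
  case Nil
  then show ?thesis by simp
next
  case (Cons b v)
  moreover assume "freely_reduced w"
  ultimately show ?thesis
    by (cases v) (auto simp: freely_reduced_def)
qed

lemma free_reduce_append_right: "free_reduce (u @ free_reduce v) = free_reduce (u @ v)"
  by (induction u)
    (simp_all add: free_reduce_Cons free_reduce_id freely_reduced_free_reduce)

lemma free_reduce_cons_cancel_append:
  "free_reduce (cons_cancel a u @ v) = cons_cancel a (free_reduce (u @ v))"
proof (cases u)
  case Nil
  then show ?thesis by (simp add: free_reduce_Cons)
next
  case (Cons b w)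
  then show ?thesis
    by (auto simp: free_reduce_Cons cons_cancel_inv_letter freely_reduced_free_reduce)
qed

lemma free_reduce_append_left: "free_reduce (free_reduce u @ v) = free_reduce (u @ v)"
proof (induction u)
  case Nil
  show ?case by (simp add: free_reduce_def)
next
  case (Cons a u)
  then show ?case
    by (simp add: free_reduce_Cons free_reduce_cons_cancel_append)
qed

lemma set_free_reduce: "set (free_reduce w) \<subseteq> set w"
proof (induction w)
  case Nil
  show ?case by (simp add: free_reduce_def)
next
  case (Cons a w)
  have "set (cons_cancel a v) \<subseteq> insert a (set v)" for v
    by (cases v) auto
  with Cons show ?case by (fastforce simp: free_reduce_Cons)
qed

lemma free_reduce_in_lists: "w \<in> lists A \<Longrightarrow> free_reduce w \<in> lists A"
  using set_free_reduce[of w] by (auto simp: in_lists_conv_set)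

lemma free_reduce_rev_inv: "free_reduce (rev (map inv_letter w) @ w) = []"
proof (induction w)
  case Nil
  show ?case by (simp add: free_reduce_def)
next
  case (Cons a w)
  have "free_reduce ([inv_letter a, a] @ w) = free_reduce w"
    using cons_cancel_inv_letter[of "free_reduce w" "inv_letter a"]
    by (simp add: free_reduce_Cons freely_reduced_free_reduce)
  then have "free_reduce (rev (map inv_letter w) @ [inv_letter a, a] @ w) = []"
    using Cons free_reduce_append_right[of "rev (map inv_letter w)" "[inv_letter a, a] @ w"]
      free_reduce_append_right[of "rev (map inv_letter w)" w]
    by simp
  then show ?case by simp
qed

lemma group_free_group: "group (free_group m)"
proof (rule groupI)
  fix u assume u: "u \<in> carrier (free_group m)"
  let ?v = "free_reduce (rev (map inv_letter u))"
  have "rev (map inv_letter u) \<in> lists (letters m)"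
    using u by (auto simp: free_group_def in_lists_conv_set)
  then have "?v \<in> carrier (free_group m)"
    using free_reduce_in_lists by (simp add: free_group_def freely_reduced_free_reduce)
  moreover have "?v \<otimes>\<^bsub>free_group m\<^esub> u = \<one>\<^bsub>free_group m\<^esub>"
    by (simp add: free_group_def free_reduce_append_left free_reduce_rev_inv)
  ultimately show "\<exists>v \<in> carrier (free_group m). v \<otimes>\<^bsub>free_group m\<^esub> u = \<one>\<^bsub>free_group m\<^esub>"
    by blast
qed (use free_reduce_in_lists in
      \<open>auto simp: free_group_def freely_reduced_free_reduce free_reduce_append_left
         free_reduce_append_right free_reduce_id\<close>)


section \<open>Cayley graphs, ends and strict dead ends\<close>

text \<open>
  Below, \<open>G\<close> is a group generated by the family \<open>x 0, \<dots>, x (m - 1)\<close>. The family is not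
  required to be injective: arcs of the Cayley graph are labelled by formal letters.
\<close>

definition letter_value :: "('a, 'b) monoid_scheme \<Rightarrow> (nat \<Rightarrow> 'a) \<Rightarrow> letter \<Rightarrow> 'a" where
  "letter_value G x a = (if snd a then x (fst a) else inv\<^bsub>G\<^esub> (x (fst a)))"

definition word_value :: "('a, 'b) monoid_scheme \<Rightarrow> (nat \<Rightarrow> 'a) \<Rightarrow> word \<Rightarrow> 'a" where
  "word_value G x w = foldr (\<lambda>a g. letter_value G x a \<otimes>\<^bsub>G\<^esub> g) w \<one>\<^bsub>G\<^esub>"

definition cayley_graph ::
    "('a, 'b) monoid_scheme \<Rightarrow> nat \<Rightarrow> (nat \<Rightarrow> 'a) \<Rightarrow> ('a, 'a \<times> letter) pre_digraph" where
  "cayley_graph G m x =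
     \<lparr>verts = carrier G,
      arcs = carrier G \<times> letters m,
      tail = fst,
      head = (\<lambda>(g, a). g \<otimes>\<^bsub>G\<^esub> letter_value G x a)\<rparr>"

definition word_length :: "('a, 'b) monoid_scheme \<Rightarrow> nat \<Rightarrow> (nat \<Rightarrow> 'a) \<Rightarrow> 'a \<Rightarrow> nat" where
  "word_length G m x g =
     (LEAST n. \<exists>p. pre_digraph.awalk (cayley_graph G m x) g p \<one>\<^bsub>G\<^esub> \<and> length p = n)"

definition cayley_ball :: "('a, 'b) monoid_scheme \<Rightarrow> nat \<Rightarrow> (nat \<Rightarrow> 'a) \<Rightarrow> nat \<Rightarrow> 'a set" where
  "cayley_ball G m x n = {g \<in> carrier G. word_length G m x g \<le> n}"

text \<open>
  Every arc of a Cayley graph has an inverse arc, so the connected components (of the graph or of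
  an induced subgraph) are the strongly connected ones.
\<close>

definition infinite_components_outside ::
    "('a, 'b) monoid_scheme \<Rightarrow> nat \<Rightarrow> (nat \<Rightarrow> 'a) \<Rightarrow> nat \<Rightarrow> 'a set set" where
  "infinite_components_outside G m x n =
     {C \<in> pre_digraph.sccs_verts (cayley_graph G m x \<restriction> (carrier G - cayley_ball G m x n)).
        infinite C}"

definition has_number_of_ends ::
    "('a, 'b) monoid_scheme \<Rightarrow> nat \<Rightarrow> (nat \<Rightarrow> 'a) \<Rightarrow> enat \<Rightarrow> bool" where
  "has_number_of_ends G m x e \<longleftrightarrow>
     (\<lambda>n. let \<C> = infinite_components_outside G m x n
          in if finite \<C> then enat (card \<C>) else \<infinity>) \<longlonglongrightarrow> e"

text \<open>
  The depth is an integer; for \<open>k \<le> 0\<close> the condition is vacuous.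
\<close>

definition strict_dead_end ::
    "('a, 'b) monoid_scheme \<Rightarrow> nat \<Rightarrow> (nat \<Rightarrow> 'a) \<Rightarrow> int \<Rightarrow> 'a \<Rightarrow> bool" where
  "strict_dead_end G m x k g \<longleftrightarrow>
     g \<in> carrier G \<and>
     (\<forall>w \<in> lists (letters m). freely_reduced w \<and> int (length w) = k \<longrightarrow>
        (\<forall>i < length w.
           word_length G m x (g \<otimes>\<^bsub>G\<^esub> word_value G x (take i w)) >
           word_length G m x (g \<otimes>\<^bsub>G\<^esub> word_value G x (take (Suc i) w))))"

definition quotient_gen :: "nat \<Rightarrow> word set \<Rightarrow> nat \<Rightarrow> word set" where
  "quotient_gen m N i = N #>\<^bsub>free_group m\<^esub> free_gen i"

end

theory Submission
  imports Defs
begin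

text \<open>
  Let \<open>k = \<lfloor>\<rho>/2\<rfloor> - 1\<close>. By condition 3 the ball of radius \<open>k\<close> about \<open>1\<close> in the Cayley graph of \<open>F/R\<close> is a
  tree. Let \<open>\<Gamma>'\<close> be the subgraph induced on the vertices at distance \<open>\<ge> k\<close> from \<open>1\<close>. A nonempty
  finite set \<open>S\<close> of its vertices contains, by condition 2, a vertex with no outgoing generator edge
  into \<open>S\<close> and one with no incoming generator edge from \<open>S\<close>. As \<open>m \<ge> 2\<close> and each vertex of \<open>\<Gamma>'\<close> has at
  most one neighbour outside \<open>\<Gamma>'\<close>, both have a boundary edge of \<open>S\<close> inside \<open>\<Gamma>'\<close>, so at least two
  such edges exist. With one-endedness this makes \<open>\<Gamma>'\<close> 2-edge-connected.

  As in Robbins' theorem on strong orientations, there is a closed walk \<open>Z\<close> in \<open>\<Gamma>'\<close> through the whole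
  sphere of radius \<open>k\<close> that uses no edge in both directions. The dead end is \<open>g = w\<^sub>0 Z w\<^sub>0\<^sup>-\<^sup>1\<close> with
  \<open>w\<^sub>0\<close> of length \<open>k\<close> leading to \<open>Z\<close>. Relators commute modulo \<open>R'\<close>, so \<open>g = w Z\<^sub>w w\<^sup>-\<^sup>1\<close> for every reduced \<open>w\<close>
  of length \<open>k\<close>, where \<open>Z\<^sub>w\<close> is \<open>Z\<close> rotated to start at the end of \<open>w\<close>; hence multiplying \<open>g\<close> by the prefix
  of \<open>w\<close> of length \<open>i\<close> gives length at most \<open>|Z| + 2k - i\<close>. Conversely, the flow of a word through the
  edges of the Cayley graph of \<open>F/R\<close> depends only on its class modulo \<open>R'\<close>, so every representative
  makes at least \<open>|Z|\<close> steps in \<open>\<Gamma>'\<close>, and at least \<open>k + (k - i)\<close> others to reach the sphere and return.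
\<close>

section \<open>Words and word length in a marked group\<close>

definition inv_word :: "word \<Rightarrow> word" where
  "inv_word w = rev (map inv_letter w)"

lemma length_inv_word [simp]: "length (inv_word w) = length w"
  by (simp add: inv_word_def)

lemma inv_word_in_lists [simp]: "inv_word w \<in> lists (letters m) \<longleftrightarrow> w \<in> lists (letters m)"
  by (auto simp: inv_word_def in_lists_conv_set)

lemma inv_word_inv_word [simp]: "inv_word (inv_word w) = w"
  by (simp add: inv_word_def rev_map comp_def)

lemma inv_word_append [simp]: "inv_word (u @ v) = inv_word v @ inv_word u"
  by (simp add: inv_word_def)

lemma inv_word_Cons: "inv_word (a # w) = inv_word w @ [inv_letter a]"
  by (simp add: inv_word_def)

lemma inv_word_Nil [simp]: "inv_word [] = []"
  by (simp add: inv_word_def)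

lemma inv_letter_neq [simp]: "inv_letter a \<noteq> a" "a \<noteq> inv_letter a"
  by (auto simp: inv_letter_def prod_eq_iff)

lemma inv_letter_eq_iff [simp]: "inv_letter a = inv_letter b \<longleftrightarrow> a = b"
  by (metis inv_letter_inv_letter)

lemma freely_reduced_append_iff:
  "freely_reduced (u @ v) \<longleftrightarrow>
     freely_reduced u \<and> freely_reduced v \<and> (u \<noteq> [] \<longrightarrow> v \<noteq> [] \<longrightarrow> hd v \<noteq> inv_letter (last u))"
  by (auto simp: freely_reduced_def successively_append_iff)

lemma freely_reduced_inv_word [simp]: "freely_reduced (inv_word w) \<longleftrightarrow> freely_reduced w"
proof -
  have "freely_reduced (inv_word u)" if "freely_reduced u" for u
    using that unfolding freely_reduced_def inv_word_def successively_rev successively_map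
    by (rule successively_mono) (metis inv_letter_inv_letter)+
  from this[of w] this[of "inv_word w"] show ?thesis by auto
qed

lemma length_free_reduce_le: "length (free_reduce w) \<le> length w"
proof (induction w)
  case (Cons a w)
  have "length (cons_cancel a v) \<le> Suc (length v)" for v
    by (cases v) auto
  with Cons show ?case by (fastforce simp: free_reduce_Cons intro: order_trans)
qed (simp add: free_reduce_def)

lemma free_reduce_Nil [simp]: "free_reduce [] = []"
  by (simp add: free_reduce_def)

lemma free_reduce_append_inv_word: "free_reduce (w @ inv_word w) = []"
  using free_reduce_rev_inv[of "inv_word w"] inv_word_inv_word[of w]
  by (simp add: inv_word_def)

text \<open>\<open>generated\<close> makes the Cayley graph connected, so the minimum defining
  \<open>word_length\<close> is attained. Generators may coincide or be trivial, as can happen to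
  their images in a quotient.\<close>

locale marked_group = group G for G (structure) +
  fixes m :: nat and x :: "nat \<Rightarrow> 'a"
  assumes gen_closed: "i < m \<Longrightarrow> x i \<in> carrier G"
    and generated: "g \<in> carrier G \<Longrightarrow> \<exists>w \<in> lists (letters m). word_value G x w = g"
begin

abbreviation lv :: "letter \<Rightarrow> 'a" where "lv \<equiv> letter_value G x"
abbreviation val :: "word \<Rightarrow> 'a" where "val \<equiv> word_value G x"
abbreviation depth :: "'a \<Rightarrow> nat" where "depth \<equiv> word_length G m x"
abbreviation words :: "word set" where "words \<equiv> lists (letters m)"

lemma lv_closed [simp, intro]: "a \<in> letters m \<Longrightarrow> lv a \<in> carrier G"
  by (auto simp: letters_def letter_value_def gen_closed)

lemma lv_inv_letter: "a \<in> letters m \<Longrightarrow> lv (inv_letter a) = inv (lv a)"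
  by (auto simp: letters_def letter_value_def inv_letter_def gen_closed)

lemma val_Nil [simp]: "val [] = \<one>"
  by (simp add: word_value_def)

lemma val_Cons [simp]: "val (a # w) = lv a \<otimes> val w"
  by (simp add: word_value_def)

lemma val_closed [simp, intro]: "w \<in> words \<Longrightarrow> val w \<in> carrier G"
  by (induction w) auto

lemma val_append: "u \<in> words \<Longrightarrow> v \<in> words \<Longrightarrow> val (u @ v) = val u \<otimes> val v"
  by (induction u) (auto simp: m_assoc)

lemma val_inv_word: "w \<in> words \<Longrightarrow> val (inv_word w) = inv (val w)"
  by (induction w)
    (auto simp: inv_word_Cons val_append lv_inv_letter inv_mult_group)

lemma val_cons_cancel:
  "a \<in> letters m \<Longrightarrow> w \<in> words \<Longrightarrow> val (cons_cancel a w) = lv a \<otimes> val w"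
  by (cases w) (auto simp: lv_inv_letter m_assoc[symmetric])

lemma val_free_reduce: "w \<in> words \<Longrightarrow> val (free_reduce w) = val w"
  by (induction w) (auto simp: free_reduce_Cons val_cons_cancel free_reduce_in_lists)

lemma mult_val_append:
  "g \<in> carrier G \<Longrightarrow> u \<in> words \<Longrightarrow> v \<in> words \<Longrightarrow> g \<otimes> val (u @ v) = g \<otimes> val u \<otimes> val v"
  by (simp add: val_append m_assoc)

lemma mult_lv_inv:
  "g \<in> carrier G \<Longrightarrow> a \<in> letters m \<Longrightarrow> g \<otimes> lv a \<otimes> lv (inv_letter a) = g"
  by (simp add: lv_inv_letter m_assoc)


section \<open>Walks spelled by words, and word length as the least length of a representing
  word\<close>

fun steps :: "'a \<Rightarrow> word \<Rightarrow> ('a \<times> letter) list" where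
  "steps g [] = []"
| "steps g (a # w) = (g, a) # steps (g \<otimes> lv a) w"

lemma length_steps [simp]: "length (steps g w) = length w"
  by (induction w arbitrary: g) auto

lemma steps_append:
  "g \<in> carrier G \<Longrightarrow> u \<in> words \<Longrightarrow> v \<in> words \<Longrightarrow>
     steps g (u @ v) = steps g u @ steps (g \<otimes> val u) v"
  by (induction u arbitrary: g) (auto simp: m_assoc)

lemma awalk_imp_word:
  assumes "pre_digraph.awalk (cayley_graph G m x) g p h"
  shows "\<exists>w \<in> words. length w = length p \<and> h = g \<otimes> val w"
proof -
  have "\<exists>w \<in> words. length w = length p \<and> h = g \<otimes> val w"
    if "set p \<subseteq> arcs (cayley_graph G m x)" "pre_digraph.cas (cayley_graph G m x) g p h"
      "g \<in> carrier G"
    using that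
  proof (induction p arbitrary: g)
    case Nil
    then show ?case by (auto simp: pre_digraph.cas.simps intro!: bexI[of _ "[]"])
  next
    case (Cons e p)
    obtain g' a where e: "e = (g', a)" by (cases e)
    with Cons.prems have *: "g' = g" "a \<in> letters m"
      "pre_digraph.cas (cayley_graph G m x) (g \<otimes> lv a) p h"
      by (auto simp: pre_digraph.cas.simps cayley_graph_def)
    with Cons obtain w where "w \<in> words" "length w = length p" "h = g \<otimes> lv a \<otimes> val w"
      by (metis insert_subset list.simps(15) lv_closed m_closed)
    with * Cons.prems show ?case
      by (intro bexI[of _ "a # w"]) (auto simp: m_assoc)
  qed
  with assms show ?thesis
    by (auto simp: pre_digraph.awalk_def cayley_graph_def)
qed

lemma awalk_steps:
  assumes "g \<in> carrier G" "w \<in> words"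
  shows "pre_digraph.awalk (cayley_graph G m x) g (steps g w) (g \<otimes> val w)"
  using assms
proof (induction w arbitrary: g)
  case Nil
  then show ?case by (auto simp: pre_digraph.awalk_def pre_digraph.cas.simps cayley_graph_def)
next
  case (Cons a w)
  then have "pre_digraph.awalk (cayley_graph G m x) (g \<otimes> lv a) (steps (g \<otimes> lv a) w)
      (g \<otimes> lv a \<otimes> val w)" by auto
  with Cons.prems show ?case
    by (auto simp: pre_digraph.awalk_def pre_digraph.cas.simps cayley_graph_def m_assoc)
qed

text \<open>A walk from \<open>g\<close> to the identity spells the inverse of \<open>g\<close>;
  inverting the word keeps its length and gives a word for \<open>g\<close> itself.\<close>

lemma ex_awalk_to_one_iff:
  assumes "g \<in> carrier G"
  shows "(\<exists>p. pre_digraph.awalk (cayley_graph G m x) g p \<one> \<and> length p = n) \<longleftrightarrow>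
    (\<exists>w \<in> words. length w = n \<and> val w = g)"
proof
  assume "\<exists>p. pre_digraph.awalk (cayley_graph G m x) g p \<one> \<and> length p = n"
  then obtain w where w: "w \<in> words" "length w = n" "\<one> = g \<otimes> val w"
    using awalk_imp_word by metis
  then have "val (inv_word w) = g"
    by (metis assms inv_equality val_closed val_inv_word)
  with w show "\<exists>w \<in> words. length w = n \<and> val w = g"
    by (intro bexI[of _ "inv_word w"]) auto
next
  assume "\<exists>w \<in> words. length w = n \<and> val w = g"
  then obtain w where w: "w \<in> words" "length w = n" "val w = g" by auto
  then have "g \<otimes> val (inv_word w) = \<one>" using assms by (simp add: val_inv_word)
  with awalk_steps[of g "inv_word w"] assms w
  show "\<exists>p. pre_digraph.awalk (cayley_graph G m x) g p \<one> \<and> length p = n"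
    by (auto intro!: exI[of _ "steps g (inv_word w)"])
qed

lemma depth_eq_Least: "g \<in> carrier G \<Longrightarrow> depth g = (LEAST n. \<exists>w \<in> words. length w = n \<and> val w = g)"
  unfolding word_length_def by (simp add: ex_awalk_to_one_iff)

lemma depth_le: "w \<in> words \<Longrightarrow> depth (val w) \<le> length w"
  using depth_eq_Least[of "val w"] by (auto intro: Least_le)

lemma geodesic:
  assumes "g \<in> carrier G"
  obtains w where "w \<in> words" "length w = depth g" "val w = g"
proof -
  have "\<exists>n. \<exists>w \<in> words. length w = n \<and> val w = g" using generated[OF assms] by auto
  from LeastI_ex[OF this] that show thesis by (auto simp: depth_eq_Least[OF assms])
qed

lemma depth_mult_val_le:
  assumes "g \<in> carrier G" "w \<in> words"
  shows "depth (g \<otimes> val w) \<le> depth g + length w"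
proof -
  obtain u where u: "u \<in> words" "length u = depth g" "val u = g" using geodesic assms by metis
  then have "g \<otimes> val w = val (u @ w)" using assms by (simp add: val_append)
  then show ?thesis using depth_le[of "u @ w"] u assms by simp
qed

lemma depth_one [simp]: "depth \<one> = 0"
  using depth_le[of "[]"] by simp

lemma depth_mult_lv_le:
  "g \<in> carrier G \<Longrightarrow> a \<in> letters m \<Longrightarrow> depth (g \<otimes> lv a) \<le> Suc (depth g)"
  using depth_mult_val_le[of g "[a]"] by simp

lemma depth_le_mult_lv:
  "g \<in> carrier G \<Longrightarrow> a \<in> letters m \<Longrightarrow> depth g \<le> Suc (depth (g \<otimes> lv a))"
  using depth_mult_lv_le[of "g \<otimes> lv a" "inv_letter a"] by (simp add: mult_lv_inv)

lemma finite_letters: "finite (letters m)"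
  by (simp add: letters_def)

lemma finite_ball: "finite {g \<in> carrier G. depth g \<le> n}"
proof (rule finite_subset)
  show "{g \<in> carrier G. depth g \<le> n} \<subseteq> val ` {w. set w \<subseteq> letters m \<and> length w \<le> n}"
    by (auto elim!: geodesic simp: in_lists_conv_set image_iff Bex_def)
  show "finite (val ` {w. set w \<subseteq> letters m \<and> length w \<le> n})"
    using finite_lists_length_le[OF finite_letters] by auto
qed

end

section \<open>Circuits without two-way edges\<close>

context marked_group
begin

section \<open>Reversal of arcs; arcs and vertices met by a word\<close>

abbreviation Arcs :: "('a \<times> letter) set" where "Arcs \<equiv> carrier G \<times> letters m"

definition rev_arc :: "'a \<times> letter \<Rightarrow> 'a \<times> letter" where
  "rev_arc e = (fst e \<otimes> lv (snd e), inv_letter (snd e))"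

lemma rev_arc_Pair: "rev_arc (g, a) = (g \<otimes> lv a, inv_letter a)"
  by (simp add: rev_arc_def)

lemma rev_arc_in_Arcs [simp]: "e \<in> Arcs \<Longrightarrow> rev_arc e \<in> Arcs"
  by (auto simp: rev_arc_def)

lemma rev_arc_rev_arc [simp]: "e \<in> Arcs \<Longrightarrow> rev_arc (rev_arc e) = e"
  by (auto simp: rev_arc_def mult_lv_inv)

text \<open>The formal labels differ, so this covers loops and generators of order two as
  well.\<close>

lemma rev_arc_neq: "rev_arc e \<noteq> e"
  by (metis inv_letter_neq(1) rev_arc_def snd_conv)

lemma set_steps_subset: "g \<in> carrier G \<Longrightarrow> w \<in> words \<Longrightarrow> set (steps g w) \<subseteq> Arcs"
  by (induction w arbitrary: g) auto

lemma steps_split: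
  assumes "e \<in> set (steps g w)" "g \<in> carrier G" "w \<in> words"
  obtains u a v where "w = u @ a # v" "e = (g \<otimes> val u, a)"
proof -
  have "\<exists>u a v. w = u @ a # v \<and> e = (g \<otimes> val u, a)"
    using assms
  proof (induction w arbitrary: g)
    case (Cons b w)
    show ?case
    proof (cases "e = (g, b)")
      case True
      then show ?thesis using Cons.prems by - (rule exI[of _ "[]"], auto)
    next
      case False
      then have "\<exists>u a v. w = u @ a # v \<and> e = (g \<otimes> lv b \<otimes> val u, a)"
        using Cons.prems by (intro Cons.IH) auto
      then obtain u a v where "w = u @ a # v" "e = (g \<otimes> lv b \<otimes> val u, a)" by blast
      then show ?thesis using Cons.prems by - (rule exI[of _ "b # u"], auto simp: m_assoc)
    qed
  qed auto
  then show thesis using that by blast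
qed

fun visits :: "'a \<Rightarrow> word \<Rightarrow> 'a set" where
  "visits g [] = {g}"
| "visits g (a # w) = insert g (visits (g \<otimes> lv a) w)"

lemma visits_append:
  "g \<in> carrier G \<Longrightarrow> u \<in> words \<Longrightarrow> v \<in> words \<Longrightarrow>
     visits g (u @ v) = visits g u \<union> visits (g \<otimes> val u) v"
proof (induction u arbitrary: g)
  case Nil
  then show ?case by (cases v) auto
qed (auto simp: m_assoc)

lemma start_in_visits [simp]: "g \<in> visits g w"
  by (cases w) auto

lemma end_in_visits [simp]: "g \<in> carrier G \<Longrightarrow> w \<in> words \<Longrightarrow> g \<otimes> val w \<in> visits g w"
  by (induction w arbitrary: g) (auto simp: m_assoc[symmetric])

lemma visits_split:
  assumes "h \<in> visits g w" "g \<in> carrier G" "w \<in> words"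
  obtains u v where "w = u @ v" "h = g \<otimes> val u"
proof -
  have "\<exists>u v. w = u @ v \<and> h = g \<otimes> val u"
    using assms
  proof (induction w arbitrary: g)
    case (Cons b w)
    show ?case
    proof (cases "h = g")
      case True
      then show ?thesis using Cons.prems by - (rule exI[of _ "[]"], auto)
    next
      case False
      then have "\<exists>u v. w = u @ v \<and> h = g \<otimes> lv b \<otimes> val u"
        using Cons.prems by (intro Cons.IH) auto
      then obtain u v where "w = u @ v" "h = g \<otimes> lv b \<otimes> val u" by blast
      then show ?thesis using Cons.prems by - (rule exI[of _ "b # u"], auto simp: m_assoc)
    qed
  qed auto
  then show thesis using that by blast
qed

lemma visits_steps:
  assumes "(h, a) \<in> set (steps g w)"
  shows "h \<in> visits g w" "h \<otimes> lv a \<in> visits g w"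
  using assms by (induction w arbitrary: g) auto

section \<open>One-way circuits, built up by adding ears\<close>

definition oneway :: "('a \<times> letter) set \<Rightarrow> bool" where
  "oneway A \<longleftrightarrow> (\<forall>e \<in> A. rev_arc e \<notin> A)"

text \<open>Arcs may be repeated in the same direction. Only opposite use of an edge is excluded,
  because only that would cancel in the flow of the circuit.\<close>

definition oneway_circuit :: "'a set \<Rightarrow> 'a \<Rightarrow> word \<Rightarrow> bool" where
  "oneway_circuit V g w \<longleftrightarrow>
     w \<in> words \<and> g \<otimes> val w = g \<and> visits g w \<subseteq> V \<and> oneway (set (steps g w))"

text \<open>Encoded by cuts: whichever arc \<open>e\<close> is set aside, another one leaves
  \<open>S\<close>, so at least two do. Each boundary edge is counted once, since its reverse leaves
  the complement.\<close>

definition two_edge_connected :: "'a set \<Rightarrow> bool" where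
  "two_edge_connected V \<longleftrightarrow> V \<subseteq> carrier G \<and>
     (\<forall>S e. S \<subseteq> V \<longrightarrow> S \<noteq> {} \<longrightarrow> S \<noteq> V \<longrightarrow>
        (\<exists>s \<in> S. \<exists>a \<in> letters m. s \<otimes> lv a \<in> V - S \<and> (s, a) \<noteq> e))"

lemma two_edge_connectedD:
  assumes "two_edge_connected V" "S \<subseteq> V" "S \<noteq> {}" "S \<noteq> V"
  obtains s a where "s \<in> S" "a \<in> letters m" "s \<otimes> lv a \<in> V - S" "(s, a) \<noteq> e"
  using assms unfolding two_edge_connected_def by blast

text \<open>Deleting the edge of \<open>(x0, a)\<close> does not disconnect \<open>V\<close>, so its
  far end still has a route back to \<open>K\<close>. A shortest such route never undoes a step and
  meets \<open>K\<close> only at its end.\<close>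

lemma ear:
  assumes V: "two_edge_connected V"
    and K: "K \<subseteq> V" "x0 \<in> K" and a: "a \<in> letters m" "x0 \<otimes> lv a \<in> V - K"
  obtains u where "u \<in> words" "visits (x0 \<otimes> lv a) u \<subseteq> V" "x0 \<otimes> lv a \<otimes> val u \<in> K"
    "oneway (set (steps (x0 \<otimes> lv a) u))"
    "(x0, a) \<notin> set (steps (x0 \<otimes> lv a) u)" "rev_arc (x0, a) \<notin> set (steps (x0 \<otimes> lv a) u)"
    "\<And>h b. (h, b) \<in> set (steps (x0 \<otimes> lv a) u) \<Longrightarrow> h \<notin> K"
proof -
  define y where "y = x0 \<otimes> lv a"
  have VG: "V \<subseteq> carrier G" using V by (simp add: two_edge_connected_def)
  have x0: "x0 \<in> carrier G" using K VG by auto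
  have y: "y \<in> carrier G" "y \<in> V" "y \<notin> K" using x0 a by (auto simp: y_def)
  define P where "P u \<longleftrightarrow> u \<in> words \<and> visits y u \<subseteq> V \<and> (x0, a) \<notin> set (steps y u) \<and>
    rev_arc (x0, a) \<notin> set (steps y u)" for u
  \<comment> \<open>The part of \<open>V\<close> still reachable from \<open>y\<close> once the edge
    of \<open>(x0, a)\<close> is deleted in both directions.\<close>
  define C where "C = {y \<otimes> val u | u. P u}"
  have CV: "C \<subseteq> V"
  proof
    fix c assume "c \<in> C"
    then obtain u where u: "P u" "c = y \<otimes> val u" by (auto simp: C_def)
    then have "c \<in> visits y u" using y by (simp add: P_def)
    with u show "c \<in> V" by (auto simp: P_def)
  qed
  have "P []" using y by (auto simp: P_def)
  then have yC: "y \<in> C" using y by (force simp: C_def)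
  have "x0 \<in> C"
  proof (rule ccontr)
    assume nC: "x0 \<notin> C"
    then have "C \<noteq> V" using K by auto
    \<comment> \<open>An arc leaving \<open>C\<close> other than the reverse of
      \<open>(x0, a)\<close>. It is not \<open>(x0, a)\<close> either, whose tail is outside
      \<open>C\<close>, so it prolongs an admissible route beyond \<open>C\<close>.\<close>
    with V CV yC obtain s b where s: "s \<in> C" "b \<in> letters m" "s \<otimes> lv b \<in> V - C"
      "(s, b) \<noteq> rev_arc (x0, a)"
      using two_edge_connectedD[of V C "rev_arc (x0, a)"] by blast
    then obtain u where u: "P u" "s = y \<otimes> val u" by (auto simp: C_def)
    have "(s, b) \<noteq> (x0, a)" using s nC by auto
    then have "P (u @ [b])" using u s y subsetD[OF CV s(1)]
      by (auto simp: P_def visits_append steps_append)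
    moreover have "s \<otimes> lv b = y \<otimes> val (u @ [b])"
      using u s y by (simp add: mult_val_append P_def)
    ultimately have "s \<otimes> lv b \<in> C" by (auto simp: C_def)
    with s show False by auto
  qed
  then obtain u0 where "P u0 \<and> y \<otimes> val u0 \<in> K" using K by (auto simp: C_def)
  from ex_has_least_nat[of "\<lambda>u. P u \<and> y \<otimes> val u \<in> K", OF this, of length]
  obtain u where u: "P u" "y \<otimes> val u \<in> K"
    and min: "\<And>u'. P u' \<Longrightarrow> y \<otimes> val u' \<in> K \<Longrightarrow> length u \<le> length u'" by blast
  have uw: "u \<in> words" using u by (simp add: P_def)
  \<comment> \<open>An arc followed later by its reverse encloses a closed detour; cutting out all
    three leaves a shorter admissible return, against minimality.\<close>
  have no_bt: False if "u = u1 @ b # u3 @ inv_letter b # u4"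
    "y \<otimes> val u1 \<otimes> lv b \<otimes> val u3 = y \<otimes> val u1 \<otimes> lv b" for u1 b u3 u4
  proof -
    have w: "u1 \<in> words" "u3 \<in> words" "u4 \<in> words" "b \<in> letters m" using that(1) uw by auto
    have e: "y \<otimes> val (u1 @ b # u3 @ [inv_letter b]) = y \<otimes> val u1"
      using that(2) w y
      by (simp add: val_append m_assoc[symmetric]) (simp add: mult_lv_inv)
    have ueq: "u = (u1 @ b # u3 @ [inv_letter b]) @ u4" using that(1) by simp
    have w': "u1 @ b # u3 @ [inv_letter b] \<in> words" using w by simp
    have "y \<otimes> val u = y \<otimes> val (u1 @ u4)"
      unfolding ueq by (subst mult_val_append) (use w w' y e in \<open>auto simp: mult_val_append\<close>)
    moreover have "steps y u = steps y (u1 @ b # u3 @ [inv_letter b]) @ steps (y \<otimes> val u1) u4"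
      unfolding ueq by (subst steps_append) (use w w' y e in \<open>auto\<close>)
    then have "set (steps y (u1 @ u4)) \<subseteq> set (steps y u)"
      using w y by (auto simp: steps_append)
    moreover have "visits y u = visits y (u1 @ b # u3 @ [inv_letter b]) \<union> visits (y \<otimes> val u1) u4"
      unfolding ueq by (subst visits_append) (use w w' y e in \<open>auto\<close>)
    then have "visits y (u1 @ u4) \<subseteq> visits y u"
      using w y by (auto simp: visits_append)
    ultimately have "P (u1 @ u4)" "y \<otimes> val (u1 @ u4) \<in> K"
      using u w by (auto simp: P_def)
    from min[OF this] that(1) show False by simp
  qed
  have ow: "oneway (set (steps y u))"
    unfolding oneway_def
  proof (intro ballI notI)
    fix f assume f: "f \<in> set (steps y u)" "rev_arc f \<in> set (steps y u)"
    from steps_split[OF f(1) y(1) uw] obtain u1 b u2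
      where 1: "u = u1 @ b # u2" "f = (y \<otimes> val u1, b)" by metis
    have w: "u1 \<in> words" "u2 \<in> words" "b \<in> letters m" using 1 uw by auto
    have yu: "y \<otimes> val u1 \<in> carrier G" using w y by auto
    have "steps y u = steps y u1 @ f # steps (y \<otimes> val u1 \<otimes> lv b) u2"
      using 1 w y by (simp add: steps_append)
    \<comment> \<open>The reverse arc occurs before or after \<open>f\<close>. Either order is the
      pattern excluded by \<open>no_bt\<close>, with the roles of the two arcs exchanged.\<close>
    with f rev_arc_neq[of f]
    consider "rev_arc f \<in> set (steps y u1)" | "rev_arc f \<in> set (steps (y \<otimes> val u1 \<otimes> lv b) u2)"
      by auto
    then show False
    proof cases
      case 1: 1
      then obtain u5 c u6 where 2: "u1 = u5 @ c # u6" "rev_arc f = (y \<otimes> val u5, c)"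
        using steps_split y(1) w(1) by metis
      have c: "c = inv_letter b" and h: "y \<otimes> val u5 = y \<otimes> val u1 \<otimes> lv b"
        using 2 \<open>f = _\<close> by (auto simp: rev_arc_Pair)
      have w5: "u5 \<in> words" "u6 \<in> words" "c \<in> letters m" using 2 w by auto
      have "y \<otimes> val u1 = y \<otimes> val u5 \<otimes> lv c"
        unfolding h c using yu w by (simp add: mult_lv_inv)
      moreover have "y \<otimes> val u1 = y \<otimes> val u5 \<otimes> lv c \<otimes> val u6"
        using 2 w5 y by (simp add: val_append m_assoc)
      ultimately show False
        using no_bt[of u5 c u6 u2] 2 \<open>u = _\<close> c by simp
    next
      case 2: 2
      have "y \<otimes> val u1 \<otimes> lv b \<in> carrier G" using yu w by auto
      from steps_split[OF 2 this w(2)]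
      obtain u5 c u6 where 3: "u2 = u5 @ c # u6"
        "rev_arc f = (y \<otimes> val u1 \<otimes> lv b \<otimes> val u5, c)"
        by metis
      then show False
        using no_bt[of u1 b u5 u6] 1 by (simp add: rev_arc_Pair)
    qed
  qed
  \<comment> \<open>A proper prefix ending in \<open>K\<close> would already be a shorter
    return.\<close>
  have "h \<notin> K" if hb: "(h, b) \<in> set (steps y u)" for h b
  proof
    assume hK: "h \<in> K"
    from steps_split[OF hb y(1) uw] obtain u1 u2 where 1: "u = u1 @ b # u2" "h = y \<otimes> val u1"
      by (metis prod.inject)
    then have "u1 \<in> words" "b # u2 \<in> words" using uw by auto
    then have "P u1" using 1 u(1) y(1) unfolding P_def
      by (simp add: steps_append visits_append del: visits.simps steps.simps)
    from min[OF this] 1 hK show False by simp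
  qed
  with u ow uw that[of u] show thesis by (auto simp: P_def y_def)
qed

text \<open>An ear closes up through the old circuit. All its arcs have an endpoint off the old
  circuit, so they cannot reverse an arc of that circuit.\<close>

lemma add_ear:
  assumes V: "two_edge_connected V"
    and Z: "oneway_circuit V v0 Z" "v0 \<in> V"
    and x0: "x0 \<in> visits v0 Z" and a: "a \<in> letters m" "x0 \<otimes> lv a \<in> V - visits v0 Z"
  obtains Z' where "oneway_circuit V v0 Z'" "insert (x0 \<otimes> lv a) (visits v0 Z) \<subseteq> visits v0 Z'"
proof -
  define K where "K = visits v0 Z"
  define y where "y = x0 \<otimes> lv a"
  have VG: "V \<subseteq> carrier G" using V by (simp add: two_edge_connected_def)
  have v0: "v0 \<in> carrier G" using Z VG by auto
  have Zw: "Z \<in> words" "v0 \<otimes> val Z = v0" "K \<subseteq> V" and Zo: "oneway (set (steps v0 Z))"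
    using Z by (auto simp: oneway_circuit_def K_def)
  have x0K: "x0 \<in> K" "x0 \<in> carrier G" using x0 VG Zw by (auto simp: K_def)
  have y: "y \<in> V" "y \<notin> K" "y \<in> carrier G" using a VG by (auto simp: y_def K_def)
  obtain u where u: "u \<in> words" "visits y u \<subseteq> V" "y \<otimes> val u \<in> K"
    "oneway (set (steps y u))"
    "(x0, a) \<notin> set (steps y u)" "rev_arc (x0, a) \<notin> set (steps y u)"
    "\<And>h b. (h, b) \<in> set (steps y u) \<Longrightarrow> h \<notin> K"
    using ear[OF V Zw(3) x0K(1) a(1)] a(2) unfolding y_def K_def by metis
  obtain Z1 Z1' where Z1: "Z = Z1 @ Z1'" "x0 = v0 \<otimes> val Z1"
    using visits_split x0 v0 Zw by metis
  obtain Z2 Z2' where Z2: "Z = Z2 @ Z2'" "y \<otimes> val u = v0 \<otimes> val Z2"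
    using visits_split u(3)[unfolded K_def] v0 Zw(1) by metis
  have w: "Z1 \<in> words" "Z1' \<in> words" "Z2 \<in> words" "Z2' \<in> words" 
    using Zw(1) Z1(1) Z2(1) by (metis append_in_lists_conv)+
  define p where "p = a # u"
  have pw: "p \<in> words" using a u by (simp add: p_def)
  \<comment> \<open>Follow \<open>Z\<close> to \<open>x0\<close>, take the ear, and rejoin
    \<open>Z\<close> where the ear lands. The final full copy of \<open>Z\<close> restores the
    vertices that the ear bypassed; it only repeats arcs in their old direction.\<close>
  define Z' where "Z' = Z1 @ p @ Z2' @ Z"
  have Z'w: "Z' \<in> words" using w pw Zw by (simp add: Z'_def)
  have z2: "v0 \<otimes> val Z2 \<otimes> val Z2' = v0"
    using Z2(1) Zw v0 w by (simp add: mult_val_append)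
  have e1: "x0 \<otimes> val p = v0 \<otimes> val Z2"
    using Z2(2) x0K a u by (simp add: y_def p_def m_assoc)
  have steps: "set (steps v0 Z') = insert (x0, a) (set (steps y u)) \<union> set (steps v0 Z)"
  proof -
    have "steps v0 Z' = steps v0 Z1 @ steps x0 p @ steps (v0 \<otimes> val Z2) Z2' @ steps v0 Z"
      unfolding Z'_def using w pw v0 x0K Zw e1 z2 Z1(2)[symmetric]
      by (simp add: steps_append)
    moreover have "set (steps v0 Z1) \<subseteq> set (steps v0 Z)" using Z1 w v0 by (auto simp: steps_append)
    moreover have "set (steps (v0 \<otimes> val Z2) Z2') \<subseteq> set (steps v0 Z)"
      using Z2 w v0 by (simp add: steps_append)
    ultimately show ?thesis by (auto simp: y_def p_def)
  qed
  have vis: "visits v0 Z' = visits y u \<union> visits v0 Z"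
  proof -
    have "visits v0 Z' = visits v0 Z1 \<union> (visits x0 p \<union> (visits (v0 \<otimes> val Z2) Z2' \<union> visits v0 Z))"
      unfolding Z'_def using w pw v0 x0K Zw e1 z2 Z1(2)[symmetric]
      by (simp add: visits_append)
    moreover have "visits v0 Z1 \<subseteq> visits v0 Z" using Z1 w v0 by (auto simp: visits_append)
    moreover have "visits (v0 \<otimes> val Z2) Z2' \<subseteq> visits v0 Z"
      using Z2 w v0 by (simp add: visits_append)
    ultimately show ?thesis using x0 by (auto simp: y_def p_def)
  qed
  have "v0 \<otimes> val Z' = v0"
    unfolding Z'_def using w pw v0 x0K Zw e1 z2 Z1(2)[symmetric]
    by (simp add: mult_val_append)
  moreover have "oneway (set (steps v0 Z'))"
    unfolding oneway_def
  proof (intro ballI notI)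
    \<comment> \<open>Arcs of \<open>u\<close> have their tail outside \<open>K\<close> and
      \<open>(x0, a)\<close> has its head \<open>y\<close> outside \<open>K\<close>, while both ends
      of every arc of \<open>Z\<close> lie in \<open>K\<close>.\<close>
    have asym: False if "f \<in> insert (x0, a) (set (steps y u))" "rev_arc f \<in> set (steps v0 Z)" for f
    proof -
      obtain h b where f: "f = (h, b)" by (cases f)
      have fA: "f \<in> Arcs" using that(1) x0K a set_steps_subset[OF y(3) u(1)] by auto
      have "rev_arc (rev_arc f) = f" using fA by simp
      then have "h \<in> K" "h \<otimes> lv b \<in> K"
        using visits_steps[of "fst (rev_arc f)" "snd (rev_arc f)" v0 Z] that(2)
        by (auto simp: K_def f rev_arc_def)
      with that(1) u(7)[of h b] y show False by (auto simp: f y_def)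
    qed
    fix f assume f: "f \<in> set (steps v0 Z')" "rev_arc f \<in> set (steps v0 Z')"
    have fA: "f \<in> Arcs" "rev_arc (rev_arc f) = f"
      using f(1) set_steps_subset[OF v0 Z'w] by auto
    have xa: "(x0, a) \<in> Arcs" using x0K a by simp
    show False
    proof (cases "f \<in> set (steps v0 Z)")
      case True
      with f Zo steps have "rev_arc f \<in> insert (x0, a) (set (steps y u))"
        by (auto simp: oneway_def)
      with asym[of "rev_arc f"] True fA show False by simp
    next
      case False
      with f steps have f': "f \<in> insert (x0, a) (set (steps y u))" by auto
      with asym[OF f'] f(2) steps have "rev_arc f \<in> insert (x0, a) (set (steps y u))" by auto
      with f' u(4,5,6) fA(2) rev_arc_neq[of f] show False
        by (auto simp: oneway_def)
    qed
  qed
  ultimately have "oneway_circuit V v0 Z'"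
    using Z'w vis u Zw(3) by (auto simp: oneway_circuit_def K_def)
  moreover have "insert y (visits v0 Z) \<subseteq> visits v0 Z'" using vis by auto
  ultimately show thesis using that by (simp add: y_def)
qed

text \<open>The vertices that can be absorbed form a set closed under adjacency in \<open>V\<close>:
  a neighbour missed by the enlarged circuit is added by one more ear.\<close>

lemma ex_oneway_circuit_insert:
  assumes V: "two_edge_connected V" and Z: "oneway_circuit V v0 Z" "v0 \<in> V" and v: "v \<in> V"
  obtains Z' where "oneway_circuit V v0 Z'" "insert v (visits v0 Z) \<subseteq> visits v0 Z'"
proof -
  define Q where "Q = {y \<in> V. \<exists>Z'. oneway_circuit V v0 Z' \<and> insert y (visits v0 Z) \<subseteq> visits v0 Z'}"
  have "v \<in> Q"
  proof (rule ccontr)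
    assume "v \<notin> Q"
    moreover have "v0 \<in> Q" using Z by (auto simp: Q_def)
    moreover have "Q \<subseteq> V" by (auto simp: Q_def)
    ultimately have "Q \<subseteq> V" "Q \<noteq> {}" "Q \<noteq> V" using v by auto
    then obtain s a where s: "s \<in> Q" "a \<in> letters m" "s \<otimes> lv a \<in> V - Q"
      \<comment> \<open>Any arc may be set aside here: a single arc leaving \<open>Q\<close> is
        enough.\<close>
      by (rule two_edge_connectedD[OF V, of Q undefined])
    then obtain Z1 where Z1: "oneway_circuit V v0 Z1" "insert s (visits v0 Z) \<subseteq> visits v0 Z1"
      by (auto simp: Q_def)
    have "s \<otimes> lv a \<in> V - visits v0 Z1" using s Z1 by (auto simp: Q_def)
    moreover have "s \<in> visits v0 Z1" using Z1 by simp
    ultimately obtain Z2 where Z2: "oneway_circuit V v0 Z2"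
      "insert (s \<otimes> lv a) (visits v0 Z1) \<subseteq> visits v0 Z2"
      using add_ear[OF V Z1(1) Z(2) _ s(2)] by metis
    then have "insert (s \<otimes> lv a) (visits v0 Z) \<subseteq> visits v0 Z2" using Z1(2) by blast
    with s Z2 have "s \<otimes> lv a \<in> Q" unfolding Q_def by blast
    with s show False by auto
  qed
  then show thesis using that by (auto simp: Q_def)
qed

theorem ex_oneway_circuit:
  assumes V: "two_edge_connected V" and v0: "v0 \<in> V" and T: "finite T" "T \<subseteq> V"
  obtains Z where "oneway_circuit V v0 Z" "T \<subseteq> visits v0 Z"
proof -
  have "\<exists>Z. oneway_circuit V v0 Z \<and> T \<subseteq> visits v0 Z"
    using T
  proof (induction rule: finite_induct)
    case empty
    have "v0 \<in> carrier G" using V v0 by (auto simp: two_edge_connected_def)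
    then show ?case using v0 by (intro exI[of _ "[]"]) (auto simp: oneway_circuit_def oneway_def)
  next
    case (insert v T)
    then obtain Z where Z: "oneway_circuit V v0 Z" "T \<subseteq> visits v0 Z" by auto
    obtain Z' where "oneway_circuit V v0 Z'" "insert v (visits v0 Z) \<subseteq> visits v0 Z'"
      using ex_oneway_circuit_insert[OF V Z(1) v0, of v] insert.prems by auto
    with Z show ?case by (intro exI[of _ Z']) auto
  qed
  then show thesis using that by blast
qed

end

section \<open>Flows\<close>

context marked_group
begin

text \<open>The coefficient at \<open>e\<close> of the cellular 1-chain of the walk that
  \<open>w\<close> spells from \<open>g\<close>.\<close>

definition flow :: "'a \<Rightarrow> word \<Rightarrow> 'a \<times> letter \<Rightarrow> int" where
  "flow g w e = int (count_list (steps g w) e) - int (count_list (steps g w) (rev_arc e))"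

lemma flow_Nil [simp]: "flow g [] e = 0"
  by (simp add: flow_def)

lemma flow_append:
  "g \<in> carrier G \<Longrightarrow> u \<in> words \<Longrightarrow> v \<in> words \<Longrightarrow>
     flow g (u @ v) e = flow g u e + flow (g \<otimes> val u) v e"
  by (simp add: flow_def steps_append)

lemma flow_Cons: "flow g (a # w) e = flow g [a] e + flow (g \<otimes> lv a) w e"
  by (simp add: flow_def)

lemma flow_backtrack:
  assumes "g \<in> carrier G" "a \<in> letters m" "e \<in> Arcs"
  shows "flow g [a] e + flow (g \<otimes> lv a) [inv_letter a] e = 0"
proof -
  have "(g, a) = rev_arc e \<longleftrightarrow> rev_arc (g, a) = e" "rev_arc (g, a) = rev_arc e \<longleftrightarrow> (g, a) = e"
    using assms by (metis SigmaI rev_arc_rev_arc)+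
  then show ?thesis by (auto simp: flow_def rev_arc_Pair)
qed

text \<open>A cancelled pair of letters crosses one edge forth and back, which contributes
  nothing.\<close>

lemma flow_cons_cancel:
  assumes "g \<in> carrier G" "a \<in> letters m" "e \<in> Arcs" "w \<in> words"
  shows "flow g (cons_cancel a w) e = flow g (a # w) e"
proof (cases "\<exists>v. w = inv_letter a # v")
  case True
  then obtain v where v: "w = inv_letter a # v" by blast
  have "flow g (a # w) e = flow g [a] e + (flow (g \<otimes> lv a) [inv_letter a] e
      + flow (g \<otimes> lv a \<otimes> lv (inv_letter a)) v e)"
    unfolding v by (subst flow_Cons, subst flow_Cons) simp
  with flow_backtrack[OF assms(1-3)] assms v show ?thesis by (simp add: mult_lv_inv)
next
  case False
  then show ?thesis by (cases w) auto
qed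

lemma flow_free_reduce:
  assumes "g \<in> carrier G" "e \<in> Arcs" "w \<in> words"
  shows "flow g (free_reduce w) e = flow g w e"
  using assms(1,3)
proof (induction w arbitrary: g)
  case (Cons a w)
  then have "flow g (free_reduce (a # w)) e = flow g (a # free_reduce w) e"
    by (simp add: free_reduce_Cons flow_cons_cancel free_reduce_in_lists assms(2))
  also have "\<dots> = flow g [a] e + flow (g \<otimes> lv a) (free_reduce w) e" by (rule flow_Cons)
  also have "\<dots> = flow g [a] e + flow (g \<otimes> lv a) w e" using Cons by simp
  also have "\<dots> = flow g (a # w) e" by (rule flow_Cons[symmetric])
  finally show ?case .
qed simp

lemma flow_inv_word:
  assumes "e \<in> Arcs" "w \<in> words" "g \<in> carrier G"
  shows "flow (g \<otimes> val w) (inv_word w) e = - flow g w e"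
proof -
  have "flow g (w @ inv_word w) e = 0"
    using flow_free_reduce[of g e "w @ inv_word w"] assms by (simp add: free_reduce_append_inv_word)
  then show ?thesis using assms by (simp add: flow_append)
qed

lemma sum_count_list_le:
  assumes "finite T" "\<And>e. e \<in> T \<Longrightarrow> P e"
  shows "(\<Sum>e\<in>T. count_list xs e) \<le> length (filter P xs)"
proof (induction xs)
  case (Cons y xs)
  have "(\<Sum>e\<in>T. count_list (y # xs) e) = (\<Sum>e\<in>T. count_list xs e + (if e = y then 1 else 0))"
    by (intro sum.cong) auto
  also have "\<dots> = (\<Sum>e\<in>T. count_list xs e) + (if y \<in> T then 1 else 0)"
    using assms(1) by (simp add: sum.distrib)
  also have "\<dots> \<le> length (filter P (y # xs))" using Cons assms(2) by auto
  finally show ?case .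
qed simp

text \<open>Dropping the backward crossings only increases the sum. Hence prescribed flows force a
  number of steps on every word that has them.\<close>

lemma sum_flow_le:
  assumes "finite T" "\<And>e. e \<in> T \<Longrightarrow> P e"
  shows "(\<Sum>e\<in>T. flow g w e) \<le> int (length (filter P (steps g w)))"
proof -
  have "(\<Sum>e\<in>T. flow g w e) \<le> (\<Sum>e\<in>T. int (count_list (steps g w) e))"
    by (intro sum_mono) (simp add: flow_def)
  moreover have "(\<Sum>e\<in>T. int (count_list (steps g w) e)) \<le> int (length (filter P (steps g w)))"
    using sum_count_list_le[OF assms, where xs = "steps g w"]
    by (simp flip: of_nat_sum)
  ultimately show ?thesis by linarith
qed

text \<open>Nothing is subtracted on a one-way walk: flows are multiplicities, and these add up to
  the length.\<close>

lemma sum_flow_oneway: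
  assumes "oneway (set (steps g w))"
  shows "(\<Sum>e\<in>set (steps g w). flow g w e) = int (length w)"
proof -
  have "(\<Sum>e\<in>set (steps g w). flow g w e) = (\<Sum>e\<in>set (steps g w). int (count_list (steps g w) e))"
    using assms by (intro sum.cong) (auto simp: flow_def oneway_def)
  also have "\<dots> = int (\<Sum>e\<in>set (steps g w). count_list (steps g w) e)" by simp
  also have "\<dots> = int (length w)" by (subst sum_count_set) auto
  finally show ?thesis .
qed

section \<open>Arcs of \<open>\<Gamma>'\<close>, and the number of steps spent outside it\<close>

definition outer :: "nat \<Rightarrow> 'a \<times> letter \<Rightarrow> bool" where
  "outer k e \<longleftrightarrow> k \<le> depth (fst e) \<and> k \<le> depth (fst e \<otimes> lv (snd e))"

lemma outer_rev_arc [simp]: "e \<in> Arcs \<Longrightarrow> outer k (rev_arc e) \<longleftrightarrow> outer k e"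
  by (auto simp: outer_def rev_arc_def mult_lv_inv)

text \<open>The depth capped at \<open>k\<close> equals \<open>k\<close> at both ends of an outer
  step and changes by at most one along any other step.\<close>

lemma depth_change_le_inner_steps:
  assumes "g \<in> carrier G" "w \<in> words"
  shows "min k (depth (g \<otimes> val w)) \<le> min k (depth g) + length (filter (\<lambda>e. \<not> outer k e) (steps g w))"
    and "min k (depth g) \<le> min k (depth (g \<otimes> val w)) + length (filter (\<lambda>e. \<not> outer k e) (steps g w))"
  using assms
proof (induction w arbitrary: g)
  case (Cons a w)
  {
    case 1
    with Cons.IH(1)[of "g \<otimes> lv a"] depth_mult_lv_le[of g a] show ?case
      by (auto simp: outer_def m_assoc)
  next
    case 2
    with Cons.IH(2)[of "g \<otimes> lv a"] depth_le_mult_lv[of g a] show ?case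
      by (auto simp: outer_def m_assoc)
  }
qed auto

text \<open>Split the word at the outer step. Climbing to depth \<open>k\<close> before it costs
  \<open>k\<close> inner steps, and descending afterwards to the final depth costs the
  difference.\<close>

lemma length_ge_if_outer_step:
  assumes "w \<in> words" "e \<in> set (steps \<one> w)" "outer k e" "depth (val w) \<le> k"
  shows "length (filter (outer k) (steps \<one> w)) + k + (k - depth (val w)) \<le> length w"
proof -
  obtain u a v where w: "w = u @ a # v" and e: "e = (\<one> \<otimes> val u, a)"
    using steps_split[OF assms(2) one_closed assms(1)] by metis
  have *: "u \<in> words" "a # v \<in> words" using assms(1) w by auto
  have k: "k \<le> depth (val u)" using assms(3) e * by (simp add: outer_def)
  let ?N = "\<lambda>g w. length (filter (\<lambda>e. \<not> outer k e) (steps g w))"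
  have "k \<le> ?N \<one> u"
    using depth_change_le_inner_steps(1)[of \<one> u k] * k by simp
  moreover have "k \<le> depth (val w) + ?N (val u) (a # v)"
    using depth_change_le_inner_steps(2)[of "val u" "a # v" k] * k assms(4)
    by (simp add: w val_append del: val_Cons steps.simps)
  moreover have "?N \<one> w = ?N \<one> u + ?N (val u) (a # v)"
    using * by (simp add: w steps_append del: steps.simps)
  moreover have "length w = length (filter (outer k) (steps \<one> w)) + ?N \<one> w"
    using sum_length_filter_compl[of "outer k" "steps \<one> w"] by simp
  ultimately show ?thesis by linarith
qed

lemma flow_eq_0_if_inner:
  assumes "\<And>e. e \<in> set (steps g w) \<Longrightarrow> \<not> outer k e" "outer k e" "e \<in> Arcs"
  shows "flow g w e = 0"
proof -
  have "e \<notin> set (steps g w)" "rev_arc e \<notin> set (steps g w)"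
    using assms outer_rev_arc by blast+
  then show ?thesis by (simp add: flow_def count_list_0_iff)
qed

end

section \<open>One-ended groups\<close>

lemma image_Collect_case_prod: "(\<lambda>(a, b). f a b) ` {(a, b). P a b} = {f a b | a b. P a b}"
  by auto

context marked_group
begin

section \<open>Components of the Cayley graph outside a ball\<close>

definition outside :: "nat \<Rightarrow> 'a set" where
  "outside n = {g \<in> carrier G. n < depth g}"

abbreviation outside_graph :: "nat \<Rightarrow> ('a, 'a \<times> letter) pre_digraph" where
  "outside_graph n \<equiv> cayley_graph G m x \<restriction> outside n"

lemma outside_eq: "carrier G - cayley_ball G m x n = outside n"
  by (auto simp: outside_def cayley_ball_def)

lemma arcs_ends_outside_graph:
  "arcs_ends (outside_graph n) =
     {(g, g \<otimes> lv a) | g a. g \<in> outside n \<and> a \<in> letters m \<and> g \<otimes> lv a \<in> outside n}"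
proof -
  have "arcs (outside_graph n) = {(g, a). g \<in> outside n \<and> a \<in> letters m \<and> g \<otimes> lv a \<in> outside n}"
    by (auto simp: cayley_graph_def outside_def)
  then have "arcs_ends (outside_graph n) = (\<lambda>(g, a). (g, g \<otimes> lv a)) `
      {(g, a). g \<in> outside n \<and> a \<in> letters m \<and> g \<otimes> lv a \<in> outside n}"
    unfolding arcs_ends_conv by (intro image_cong) (auto simp: cayley_graph_def)
  then show ?thesis by (simp only: image_Collect_case_prod)
qed

lemma symmetric_outside_graph: "symmetric (outside_graph n)"
  unfolding symmetric_def sym_def arcs_ends_outside_graph
proof (clarify)
  fix g a assume "g \<in> outside n" "a \<in> letters m" "g \<otimes> lv a \<in> outside n"
  then show "\<exists>h b. (g \<otimes> lv a, g) = (h, h \<otimes> lv b) \<and> h \<in> outside n \<and> b \<in> letters m \<and> h \<otimes> lv b \<in> outside n"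
    by (intro exI[of _ "g \<otimes> lv a"] exI[of _ "inv_letter a"]) (auto simp: mult_lv_inv outside_def)
qed

lemma reachable_outside_sym:
  "g \<rightarrow>\<^sup>*\<^bsub>outside_graph n\<^esub> h \<Longrightarrow> h \<rightarrow>\<^sup>*\<^bsub>outside_graph n\<^esub> g"
  using symmetric_reachable[OF symmetric_outside_graph] .

lemma reachable_outside_trans:
  "g \<rightarrow>\<^sup>*\<^bsub>outside_graph n\<^esub> h \<Longrightarrow> h \<rightarrow>\<^sup>*\<^bsub>outside_graph n\<^esub> l \<Longrightarrow> g \<rightarrow>\<^sup>*\<^bsub>outside_graph n\<^esub> l"
  unfolding reachable_def by (rule rtrancl_on_trans)

definition component :: "nat \<Rightarrow> 'a \<Rightarrow> 'a set" where
  "component n g = {h. g \<rightarrow>\<^sup>*\<^bsub>outside_graph n\<^esub> h}"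

lemma self_in_component: "g \<in> outside n \<Longrightarrow> g \<in> component n g"
  by (simp add: component_def reachable_def)

lemma component_eq:
  assumes "g \<rightarrow>\<^sup>*\<^bsub>outside_graph n\<^esub> h"
  shows "component n g = component n h"
  using assms unfolding component_def
  by (auto intro: reachable_outside_sym reachable_outside_trans)

lemma component_subset_if_closed:
  assumes "g \<in> S"
    and closed: "\<And>s a. s \<in> S \<Longrightarrow> a \<in> letters m \<Longrightarrow> s \<otimes> lv a \<in> outside n \<Longrightarrow> s \<otimes> lv a \<in> S"
  shows "component n g \<subseteq> S"
proof
  fix h assume "h \<in> component n g"
  then have "(g, h) \<in> rtrancl_on (outside n) (arcs_ends (outside_graph n))"
    by (simp add: component_def reachable_def)
  then show "h \<in> S"
  proof (induction rule: rtrancl_on_induct)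
    case (step y z)
    then obtain a where "a \<in> letters m" "z = y \<otimes> lv a" by (auto simp: arcs_ends_outside_graph)
    with step closed show ?case by simp
  qed (rule assms(1))
qed

lemma infinite_component_in_components_outside:
  assumes "g \<in> outside n" "infinite (component n g)"
  shows "component n g \<in> infinite_components_outside G m x n"
proof -
  have "component n g \<in> pre_digraph.sccs_verts (outside_graph n)"
    unfolding pre_digraph.sccs_verts_def
    using self_in_component[OF assms(1)]
    by (auto simp: component_def intro: reachable_outside_sym reachable_outside_trans)
  with assms show ?thesis
    by (simp add: infinite_components_outside_def outside_eq)
qed

text \<open>A geodesic towards the identity stays outside the ball until depth \<open>n + 1\<close>.
  Every component thus meets a finite sphere, so there are finitely many.\<close>

lemma ex_shallow_in_component:
  assumes "g \<in> outside n"
  shows "\<exists>h \<in> component n g. depth h = Suc n"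
  using assms
proof (induction "depth g" arbitrary: g rule: less_induct)
  case less
  have g: "g \<in> carrier G" "n < depth g" using less.prems by (auto simp: outside_def)
  show ?case
  proof (cases "depth g = Suc n")
    case True
    then show ?thesis using self_in_component less.prems by blast
  next
    case False
    obtain w where w: "w \<in> words" "length w = depth g" "val w = g" using geodesic g by metis
    then have "w \<noteq> []" using g by auto
    then obtain v a where v: "w = v @ [a]" by (metis rev_exhaust)
    define h where "h = val v"
    have a: "a \<in> letters m" "v \<in> words" using v w by auto
    have ha: "g = h \<otimes> lv a" using v w a by (auto simp: h_def val_append)
    have h: "h \<in> carrier G" "h = g \<otimes> lv (inv_letter a)"
      using a unfolding ha by (auto simp: h_def mult_lv_inv)
    have "depth h < depth g" using depth_le[of v] a v w by (simp add: h_def)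
    moreover have "depth g \<le> Suc (depth h)" 
      using depth_mult_lv_le[OF h(1) a(1)] by (subst ha)
    ultimately have *: "depth h < depth g" "h \<in> outside n"
      using False g h by (auto simp: outside_def)
    have "(g, h) \<in> arcs_ends (outside_graph n)"
      unfolding arcs_ends_outside_graph using less.prems * a h(2)[symmetric]
      by (intro CollectI exI[of _ g] exI[of _ "inv_letter a"]) simp
    then have "g \<rightarrow>\<^sup>*\<^bsub>outside_graph n\<^esub> h"
      unfolding reachable_def using less.prems *(2)
      by (intro rtrancl_on_into_rtrancl_on[OF rtrancl_on_refl]) auto
    with less.hyps[OF *] component_eq show ?thesis by metis
  qed
qed

lemma finite_components: "finite (component n ` outside n)"
proof (rule finite_subset)
  show "component n ` outside n \<subseteq> component n ` {g \<in> carrier G. depth g \<le> Suc n}"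
  proof clarify
    fix g assume g: "g \<in> outside n"
    then obtain h where h: "h \<in> component n g" "depth h = Suc n" using ex_shallow_in_component by blast
    then have r: "g \<rightarrow>\<^sup>*\<^bsub>outside_graph n\<^esub> h" by (simp add: component_def)
    then have "(g, h) \<in> rtrancl_on (outside n) (arcs_ends (outside_graph n))"
      by (simp add: reachable_def)
    then have "h \<in> carrier G" by (auto dest!: in_rtrancl_on_in_F(2) simp: outside_def)
    with h component_eq[OF r] show "component n g \<in> component n ` {g \<in> carrier G. depth g \<le> Suc n}"
      by auto
  qed
  show "finite (component n ` {g \<in> carrier G. depth g \<le> Suc n})"
    using finite_ball by simp
qed

text \<open>\<open>S\<close> is a union of components. There are finitely many of them, so one
  inside an infinite \<open>S\<close> is infinite.\<close>

lemma ex_infinite_component: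
  assumes "S \<subseteq> outside n" "infinite S"
    and closed: "\<And>s a. s \<in> S \<Longrightarrow> a \<in> letters m \<Longrightarrow> s \<otimes> lv a \<in> outside n \<Longrightarrow> s \<otimes> lv a \<in> S"
  shows "\<exists>C \<in> infinite_components_outside G m x n. C \<noteq> {} \<and> C \<subseteq> S"
proof -
  have "S \<subseteq> \<Union> (component n ` S)" using self_in_component assms(1) by blast
  then have "infinite (\<Union> (component n ` S))" using assms(2) finite_subset by blast
  moreover have "finite (component n ` S)"
    using finite_components assms(1) by (meson finite_subset image_mono)
  ultimately obtain g where g: "g \<in> S" "infinite (component n g)" by blast
  with infinite_component_in_components_outside assms(1) component_subset_if_closed[OF g(1) closed]
    self_in_component
  show ?thesis by (intro bexI[of _ "component n g"]) auto
qed

text \<open>The point 1 is isolated in \<open>enat\<close>, so convergence to it means being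
  eventually equal to it.\<close>

lemma eventually_one_component:
  assumes "has_number_of_ends G m x 1"
  shows "\<forall>\<^sub>F n in sequentially. card (infinite_components_outside G m x n) = 1"
proof -
  have "open {1 :: enat}" using open_enat[of 1] by (simp add: one_enat_def)
  from topological_tendstoD[OF assms[unfolded has_number_of_ends_def] this]
  show ?thesis
    by (auto simp: Let_def one_enat_def elim!: eventually_mono split: if_splits)
qed

text \<open>Outside a ball containing all boundary vertices no arc joins \<open>S\<close> to
  \<open>V - S\<close>. If both were infinite, each would contain an infinite component.\<close>

lemma one_end_finite_side:
  assumes ends: "has_number_of_ends G m x 1"
    and S: "S \<subseteq> V" and V: "V = {g \<in> carrier G. k \<le> depth g}"
    and fin: "finite {s \<in> S. \<exists>a \<in> letters m. s \<otimes> lv a \<in> V - S}"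
  shows "finite S \<or> finite (V - S)"
proof (rule ccontr)
  assume inf: "\<not> (finite S \<or> finite (V - S))"
  define B where "B = {s \<in> S. \<exists>a \<in> letters m. s \<otimes> lv a \<in> V - S}"
  obtain N where N: "\<And>b. b \<in> B \<Longrightarrow> depth b \<le> N"
    using fin unfolding B_def[symmetric] by (metis finite_nat_set_iff_bounded_le finite_imageI imageI)
  \<comment> \<open>Beyond \<open>N\<close> no boundary vertex of \<open>S\<close> remains, and
    \<open>k \<le> n\<close> puts everything outside the ball into \<open>V\<close>.\<close>
  obtain n where n: "N \<le> n" "k \<le> n" "card (infinite_components_outside G m x n) = 1"
    using eventually_conj[OF eventually_one_component[OF ends] eventually_ge_at_top[of "max N k"]]
    by (auto simp: eventually_at_top_linorder)
  have out: "outside n \<subseteq> V" using n V by (auto simp: outside_def)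
  have inf_out: "infinite (T \<inter> outside n)" if "infinite T" "T \<subseteq> V" for T
  proof
    assume "finite (T \<inter> outside n)"
    moreover have "T - outside n \<subseteq> {g \<in> carrier G. depth g \<le> n}"
      using that V by (auto simp: outside_def)
    then have "finite (T - outside n)" using finite_ball finite_subset by blast
    ultimately show False using that by (metis Int_Diff_Un finite_Un)
  qed
  have 1: "\<exists>C \<in> infinite_components_outside G m x n. C \<noteq> {} \<and> C \<subseteq> S \<inter> outside n"
  proof (rule ex_infinite_component)
    show "infinite (S \<inter> outside n)" using inf_out inf S by blast
    fix s a assume s: "s \<in> S \<inter> outside n" "a \<in> letters m" "s \<otimes> lv a \<in> outside n"
    have "s \<notin> B" using N[of s] s n by (auto simp: outside_def)
    then have "s \<otimes> lv a \<notin> V - S" using s unfolding B_def by blast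
    with s out show "s \<otimes> lv a \<in> S \<inter> outside n" by auto
  qed auto
  have 2: "\<exists>C \<in> infinite_components_outside G m x n. C \<noteq> {} \<and> C \<subseteq> (V - S) \<inter> outside n"
  proof (rule ex_infinite_component)
    show "infinite ((V - S) \<inter> outside n)" using inf_out inf by blast
    fix s a assume s: "s \<in> (V - S) \<inter> outside n" "a \<in> letters m" "s \<otimes> lv a \<in> outside n"
    then have "s \<in> carrier G" using V by auto
    then have ret: "s \<otimes> lv a \<otimes> lv (inv_letter a) = s" using s by (simp add: mult_lv_inv)
    \<comment> \<open>A crossing from \<open>V - S\<close> into \<open>S\<close> is the reverse of a
      crossing out of \<open>S\<close>, so its head would belong to \<open>B\<close>.\<close>
    have "s \<otimes> lv a \<notin> B" using N[of "s \<otimes> lv a"] s n by (auto simp: outside_def)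
    moreover have "\<exists>b \<in> letters m. s \<otimes> lv a \<otimes> lv b \<in> V - S"
      using s ret by (intro bexI[of _ "inv_letter a"]) auto
    ultimately have "s \<otimes> lv a \<notin> S" unfolding B_def by blast
    then show "s \<otimes> lv a \<in> (V - S) \<inter> outside n" using s out by auto
  qed auto
  from 1 2 obtain C D where "C \<in> infinite_components_outside G m x n"
    "D \<in> infinite_components_outside G m x n" "C \<noteq> D" by blast
  with n(3) show False by (metis card_1_singletonE singletonD)
qed

end

section \<open>The complement of a tree ball\<close>

context marked_group
begin

lemma geodesic_reduced:
  assumes "g \<in> carrier G"
  obtains w where "w \<in> words" "freely_reduced w" "length w = depth g" "val w = g"
proof -
  obtain w where w: "w \<in> words" "length w = depth g" "val w = g" using geodesic assms by metis
  have fw: "free_reduce w \<in> words" "val (free_reduce w) = g"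
    using w by (auto simp: val_free_reduce free_reduce_in_lists)
  have "length (free_reduce w) = depth g"
    using length_free_reduce_le[of w] depth_le[OF fw(1)] w fw by simp
  with fw that freely_reduced_free_reduce show thesis by blast
qed

end

text \<open>\<open>girth\<close> concerns all freely reduced relators, not only cyclically reduced
  ones; in this form it says directly that short reduced words are determined by their
  value.\<close>

locale one_ended_tree_ball = marked_group +
  fixes k :: nat
  assumes m_ge_2: "2 \<le> m" and k_pos: "0 < k"
    and no_positive: "w \<in> words \<Longrightarrow> w \<noteq> [] \<Longrightarrow> positive_word w \<Longrightarrow> val w \<noteq> \<one>"
    and girth: "w \<in> words \<Longrightarrow> freely_reduced w \<Longrightarrow> w \<noteq> [] \<Longrightarrow> val w = \<one> \<Longrightarrow> 2 * k < length w"
    and one_end: "has_number_of_ends G m x 1"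
begin

section \<open>The graph \<open>\<Gamma>'\<close>, with vertex set \<open>far\<close>, is
  2-edge-connected\<close>

definition far :: "'a set" where
  "far = {g \<in> carrier G. k \<le> depth g}"

text \<open>\<open>u\<close> followed by the inverse of \<open>v\<close> is a relator of length at
  most \<open>2 * k\<close>, so by \<open>girth\<close> it reduces to the empty word.\<close>

lemma reduced_word_unique:
  assumes "u \<in> words" "freely_reduced u" "v \<in> words" "freely_reduced v"
    "val u = val v" "length u + length v \<le> 2 * k"
  shows "u = v"
proof -
  let ?r = "free_reduce (u @ inv_word v)"
  have "?r \<in> words" using assms by (simp add: free_reduce_in_lists)
  moreover have "val ?r = \<one>"
    using assms by (simp add: val_free_reduce val_append val_inv_word)
  moreover have "length ?r \<le> 2 * k"
    using length_free_reduce_le[of "u @ inv_word v"] assms(6) by simp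
  ultimately have r: "?r = []" using girth[of ?r] freely_reduced_free_reduce by force
  have "v = free_reduce (?r @ v)" using r assms by (simp add: free_reduce_id)
  also have "\<dots> = free_reduce (u @ (inv_word v @ v))" by (simp add: free_reduce_append_left)
  also have "\<dots> = free_reduce (u @ free_reduce (inv_word v @ v))"
    by (simp only: free_reduce_append_right)
  also have "\<dots> = u"
    using assms by (simp add: inv_word_def free_reduce_rev_inv free_reduce_id)
  finally show ?thesis ..
qed

lemma depth_reduced_word:
  assumes "w \<in> words" "freely_reduced w" "length w \<le> k"
  shows "depth (val w) = length w"
proof -
  obtain p where p: "p \<in> words" "freely_reduced p" "length p = depth (val w)" "val p = val w"
    by (rule geodesic_reduced[OF val_closed[OF assms(1)]])
  then have "p = w" using depth_le[OF assms(1)] assms by (intro reduced_word_unique) auto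
  with p show ?thesis by simp
qed

text \<open>A geodesic to a neighbour outside \<open>far\<close>, prolonged by the step back to
  \<open>g\<close>, is a reduced word of length at most \<open>k\<close>. Uniqueness of such words
  fixes its last letter.\<close>

lemma far_adjacent_unique:
  assumes "g \<in> far" "a \<in> letters m" "b \<in> letters m" "g \<otimes> lv a \<notin> far" "g \<otimes> lv b \<notin> far"
  shows "a = b"
proof -
  have g: "g \<in> carrier G" "k \<le> depth g" using assms(1) by (auto simp: far_def)
  have *: "\<exists>p. p \<in> words \<and> freely_reduced (p @ [inv_letter c]) \<and> length p < k
      \<and> val (p @ [inv_letter c]) = g"
    if c: "c \<in> letters m" "g \<otimes> lv c \<notin> far" for c
  proof -
    have gc: "g \<otimes> lv c \<in> carrier G" using g c by simp
    obtain p where p: "p \<in> words" "freely_reduced p" "length p = depth (g \<otimes> lv c)" "val p = g \<otimes> lv c"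
      by (rule geodesic_reduced[OF gc])
    have len: "length p < k" using p c gc by (auto simp: far_def)
    \<comment> \<open>Otherwise \<open>p\<close> without its last letter would reach
      \<open>g\<close> in fewer than \<open>k\<close> steps.\<close>
    have "last p \<noteq> c" if "p \<noteq> []"
    proof
      assume "last p = c"
      with that obtain q where q: "p = q @ [c]" by (metis append_butlast_last_id)
      with p(1) have "q \<in> words" by simp
      then have "val q \<otimes> lv c = g \<otimes> lv c"
        using p(4) c(1) unfolding q by (simp add: val_append)
      then have "val q = g" using \<open>q \<in> words\<close> g(1) c(1) by simp
      with depth_le[OF \<open>q \<in> words\<close>] q len g show False by simp
    qed
    then have "freely_reduced (p @ [inv_letter c])"
      using p by (auto simp: freely_reduced_append_iff) (simp add: freely_reduced_def)
    moreover have "val (p @ [inv_letter c]) = g"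
      using p c g by (simp add: val_append mult_lv_inv)
    ultimately show ?thesis using p len by blast
  qed
  obtain p q where p: "p \<in> words" "freely_reduced (p @ [inv_letter a])" "length p < k"
      "val (p @ [inv_letter a]) = g"
    and q: "q \<in> words" "freely_reduced (q @ [inv_letter b])" "length q < k"
      "val (q @ [inv_letter b]) = g"
    using *[OF assms(2,4)] *[OF assms(3,5)] by blast
  have "p @ [inv_letter a] = q @ [inv_letter b]"
    using p q assms by (intro reduced_word_unique) auto
  then show ?thesis by simp
qed

text \<open>A cycle of arcs whose letters all have sign \<open>c\<close> would spell a positive
  relator or the inverse of one. So these arcs are acyclic on \<open>S\<close>, and finiteness gives
  a last vertex.\<close>

lemma ex_sink:
  assumes "finite S" "S \<noteq> {}" "S \<subseteq> carrier G"
  shows "\<exists>s \<in> S. \<forall>i < m. s \<otimes> lv (i, c) \<notin> S"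
proof -
  \<comment> \<open>Pairs list the successor first, so that a minimal element for \<open>r\<close>
    has no successor in \<open>S\<close>.\<close>
  define r where "r = {(t, s). s \<in> S \<and> t \<in> S \<and> (\<exists>i < m. t = s \<otimes> lv (i, c))}"
  have path: "s \<in> carrier G \<and> (\<exists>w \<in> words. w \<noteq> [] \<and> (\<forall>a \<in> set w. snd a = c) \<and> t = s \<otimes> val w)"
    if "(t, s) \<in> r\<^sup>+" for s t
    using that
  proof (induction rule: trancl_induct)
    case (base s)
    then obtain i where "s \<in> carrier G" "i < m" "t = s \<otimes> lv (i, c)" using assms by (auto simp: r_def)
    then show ?case by (auto simp: letters_def intro!: bexI[of _ "[(i, c)]"])
  next
    case (step s' s)
    then obtain i w where i: "s \<in> carrier G" "i < m" "s' = s \<otimes> lv (i, c)"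
      and w: "w \<in> words" "\<forall>a \<in> set w. snd a = c" "t = s' \<otimes> val w"
      using assms by (auto simp: r_def)
    have "(i, c) \<in> letters m" using i by (simp add: letters_def)
    with i w show ?case by (intro conjI bexI[of _ "(i, c) # w"]) (auto simp: m_assoc)
  qed
  have "acyclic r"
    unfolding acyclic_def
  proof (intro allI notI)
    fix s assume "(s, s) \<in> r\<^sup>+"
    from path[OF this] obtain w where w: "w \<in> words" "w \<noteq> []" "\<forall>a \<in> set w. snd a = c"
      and s: "s \<in> carrier G" "s = s \<otimes> val w" by blast
    have "val w = \<one>" using s w by (metis l_cancel one_closed r_one val_closed)
    show False
    proof (cases c)
      case True
      with w no_positive[of w] \<open>val w = \<one>\<close> show ?thesis by (auto simp: positive_word_def)
    next
      case False
      then have "positive_word (inv_word w)"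
        using w by (auto simp: positive_word_def inv_word_def inv_letter_def)
      moreover have "val (inv_word w) = \<one>" using w \<open>val w = \<one>\<close> by (simp add: val_inv_word)
      moreover have "inv_word w \<noteq> []" using w by (simp add: inv_word_def)
      ultimately show ?thesis using no_positive[of "inv_word w"] w by simp
    qed
  qed
  moreover have "finite r" by (rule finite_subset[of _ "S \<times> S"]) (auto simp: r_def assms)
  ultimately have "wf r" by (simp add: finite_acyclic_wf)
  then obtain s where s: "s \<in> S" and min: "\<And>t. (t, s) \<in> r \<Longrightarrow> t \<notin> S"
    using assms(2) by (rule wfE_min') blast
  have "s \<otimes> lv (i, c) \<notin> S" if "i < m" for i
    using s min[of "s \<otimes> lv (i, c)"] that unfolding r_def by blast
  with s show ?thesis by blast
qed

text \<open>At a sink of \<open>S\<close> both arcs labelled by the first two generators (with sign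
  \<open>c\<close>) leave \<open>S\<close>, and at most one of them leaves
  \<open>far\<close>.\<close>

lemma ex_boundary_letter:
  assumes "finite S" "S \<noteq> {}" "S \<subseteq> far"
  shows "\<exists>s \<in> S. \<exists>i < m. s \<otimes> lv (i, c) \<in> far - S"
proof -
  have "S \<subseteq> carrier G" using assms by (auto simp: far_def)
  then obtain s where s: "s \<in> S" "\<And>i. i < m \<Longrightarrow> s \<otimes> lv (i, c) \<notin> S"
    using ex_sink[OF assms(1,2)] by blast
  have "(0, c) \<in> letters m" "(1, c) \<in> letters m" using m_ge_2 by (auto simp: letters_def)
  then have "s \<otimes> lv (0, c) \<in> far \<or> s \<otimes> lv (1, c) \<in> far"
    using far_adjacent_unique[of s "(0, c)" "(1, c)"] s(1) assms(3) by auto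
  then obtain i where "i < m" "s \<otimes> lv (i, c) \<in> far"
    using m_ge_2 by (metis One_nat_def Suc_1 Suc_le_lessD less_Suc_eq_le less_le_trans zero_less_Suc)
  then show ?thesis using s by blast
qed

text \<open>A finite \<open>S\<close> has a boundary arc with a positive label and one with a
  negative label; both cannot equal \<open>e\<close>.\<close>

lemma infinite_if_boundary_le_1:
  assumes "S \<subseteq> far" "S \<noteq> {}"
    and le1: "\<And>s a. s \<in> S \<Longrightarrow> a \<in> letters m \<Longrightarrow> s \<otimes> lv a \<in> far - S \<Longrightarrow> (s, a) = e"
  shows "infinite S"
proof
  assume fin: "finite S"
  have "snd (snd e) = c" for c
  proof -
    obtain s i where "s \<in> S" "i < m" "s \<otimes> lv (i, c) \<in> far - S"
      using ex_boundary_letter[OF fin assms(2,1), of c] by blast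
    with le1[of s "(i, c)"] show ?thesis by (auto simp: letters_def)
  qed
  from this[of True] this[of False] show False by simp
qed

text \<open>With at most one arc leaving \<open>S\<close>, both \<open>S\<close> and its complement
  in \<open>far\<close> are infinite, although their boundary is finite. One end forbids
  this.\<close>

lemma two_edge_connected_far: "two_edge_connected far"
  unfolding two_edge_connected_def
proof (intro conjI allI impI)
  show "far \<subseteq> carrier G" by (auto simp: far_def)
  fix S e assume S: "S \<subseteq> far" "S \<noteq> {}" "S \<noteq> far"
  show "\<exists>s \<in> S. \<exists>a \<in> letters m. s \<otimes> lv a \<in> far - S \<and> (s, a) \<noteq> e"
  proof (rule ccontr)
    assume "\<not> ?thesis"
    then have le1: "\<And>s a. s \<in> S \<Longrightarrow> a \<in> letters m \<Longrightarrow> s \<otimes> lv a \<in> far - S \<Longrightarrow> (s, a) = e"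
      by blast
    have "infinite S" using infinite_if_boundary_le_1[OF S(1,2) le1] by blast
    moreover have "infinite (far - S)"
    proof (rule infinite_if_boundary_le_1)
      show "far - S \<noteq> {}" using S by blast
      fix t a assume t: "t \<in> far - S" "a \<in> letters m" "t \<otimes> lv a \<in> far - (far - S)"
      then have tc: "t \<in> carrier G" by (auto simp: far_def)
      then have ret: "t \<otimes> lv a \<otimes> lv (inv_letter a) = t" using t by (simp add: mult_lv_inv)
      \<comment> \<open>Reversing an arc that leaves the complement gives one that leaves
        \<open>S\<close>.\<close>
      have "(t \<otimes> lv a, inv_letter a) = e"
        using t ret by (intro le1) auto
      then show "(t, a) = rev_arc e" using ret by (auto simp: rev_arc_def)
    qed simp
    moreover have "{s \<in> S. \<exists>a \<in> letters m. s \<otimes> lv a \<in> far - S} \<subseteq> {fst e}"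
      using le1 by fastforce
    then have "finite {s \<in> S. \<exists>a \<in> letters m. s \<otimes> lv a \<in> far - S}"
      using finite_subset by blast
    then have "finite S \<or> finite (far - S)"
      using one_end_finite_side[OF one_end S(1) far_def] by blast
    ultimately show False by blast
  qed
qed

theorem ex_oneway_circuit_through_sphere:
  assumes "w0 \<in> words" "freely_reduced w0" "length w0 = k"
  obtains Z where "oneway_circuit far (val w0) Z" "Z \<noteq> []"
    "\<And>w. w \<in> words \<Longrightarrow> freely_reduced w \<Longrightarrow> length w = k \<Longrightarrow> val w \<in> visits (val w0) Z"
proof -
  have sphere: "val w \<in> far" if "w \<in> words" "freely_reduced w" "length w = k" for w
    using that depth_reduced_word by (simp add: far_def)
  have v0: "val w0 \<in> far" using sphere assms by blast
  \<comment> \<open>A second vertex to be visited forces the circuit to be nonempty, so that it has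
    an arc in \<open>\<Gamma>'\<close>.\<close>
  obtain y where y: "y \<in> far" "y \<noteq> val w0"
    using ex_boundary_letter[of "{val w0}" True] v0 by auto
  let ?T = "insert y (val ` {w. set w \<subseteq> letters m \<and> length w = k \<and> freely_reduced w})"
  have "finite ?T"
    using finite_lists_length_eq[OF finite_letters, of k]
    by (auto intro!: finite_imageI elim!: rev_finite_subset)
  moreover have "?T \<subseteq> far" using y(1) sphere by (simp add: image_subset_iff lists_eq_set)
  ultimately obtain Z where Z: "oneway_circuit far (val w0) Z" "?T \<subseteq> visits (val w0) Z"
    by (rule ex_oneway_circuit[OF two_edge_connected_far v0])
  have "Z \<noteq> []" using Z(2) y by auto
  moreover have "val w \<in> visits (val w0) Z" if "w \<in> words" "freely_reduced w" "length w = k" for w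
    using that Z(2) by (simp add: image_subset_iff lists_eq_set)
  ultimately show thesis using that Z(1) by blast
qed

end

section \<open>Quotients of the free group\<close>

lemma (in group) inv_mult_cancel_left:
  "y \<in> carrier G \<Longrightarrow> z \<in> carrier G \<Longrightarrow> inv y \<otimes> (y \<otimes> z) = z"
  "y \<in> carrier G \<Longrightarrow> z \<in> carrier G \<Longrightarrow> y \<otimes> (inv y \<otimes> z) = z"
  by (simp_all flip: m_assoc)

text \<open>A reduced relator that is not cyclically reduced has the form
  \<open>inv_letter b # u @ [b]\<close>. Then \<open>u\<close> is a shorter reduced relator,
  nonempty because the two outer letters would otherwise cancel.\<close>

lemma (in marked_group) length_reduced_relator_ge:
  assumes cyc: "\<And>w. w \<in> words \<Longrightarrow> w \<noteq> [] \<Longrightarrow> cyclically_reduced w \<Longrightarrow> val w = \<one> \<Longrightarrow> \<rho> \<le> length w"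
    and w: "w \<in> words" "w \<noteq> []" "freely_reduced w" "val w = \<one>"
  shows "\<rho> \<le> length w"
  using w
proof (induction "length w" arbitrary: w rule: less_induct)
  case less
  show ?case
  proof (cases "cyclically_reduced w")
    case True
    then show ?thesis using cyc less.prems by blast
  next
    case False
    then have hd: "hd w = inv_letter (last w)"
      using less.prems by (auto simp: cyclically_reduced_def)
    obtain v b where v: "w = v @ [b]" using less.prems(2) by (metis rev_exhaust)
    with hd have "v \<noteq> []" by auto
    then obtain a u where u: "v = a # u" by (cases v) auto
    have a: "a = inv_letter b" using hd u v by simp
    have uw: "u \<in> words" "b \<in> letters m" using less.prems(1) u v by auto
    have ur: "freely_reduced u"
      using less.prems(3) freely_reduced_append_iff[of "[a]" "u @ [b]"] u v
      by (simp add: freely_reduced_append_iff)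
    have "u \<noteq> []" using less.prems(3) u v a by (auto simp: freely_reduced_def)
    have "inv (lv b) \<otimes> (val u \<otimes> lv b) = \<one>"
      using less.prems(4) uw u v a by (simp add: val_append lv_inv_letter)
    then have "val u \<otimes> lv b = lv b"
      using uw inv_mult_cancel_left(2)[of "lv b" "val u \<otimes> lv b"] by simp
    then have "val u = \<one>" using uw by (metis lv_closed one_closed l_one right_cancel val_closed)
    then have "\<rho> \<le> length u" using less.hyps[of u] uw ur \<open>u \<noteq> []\<close> u v by simp
    then show ?thesis using u v by simp
  qed
qed

section \<open>The free group and its quotients, with values of words as cosets\<close>

lemma carrier_free_group_iff: "u \<in> carrier (free_group m) \<longleftrightarrow> u \<in> lists (letters m) \<and> freely_reduced u"
  by (simp add: free_group_def)

lemma free_reduce_in_free_group: "w \<in> lists (letters m) \<Longrightarrow> free_reduce w \<in> carrier (free_group m)"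
  by (simp add: carrier_free_group_iff freely_reduced_free_reduce free_reduce_in_lists)

lemma mult_free_group: "u \<otimes>\<^bsub>free_group m\<^esub> v = free_reduce (u @ v)"
  by (simp add: free_group_def)

lemma one_free_group: "\<one>\<^bsub>free_group m\<^esub> = []"
  by (simp add: free_group_def)

lemma inv_free_group:
  assumes "u \<in> carrier (free_group m)"
  shows "inv\<^bsub>free_group m\<^esub> u = inv_word u"
proof (rule group.inv_equality[OF group_free_group])
  show "inv_word u \<otimes>\<^bsub>free_group m\<^esub> u = \<one>\<^bsub>free_group m\<^esub>"
    by (simp add: mult_free_group one_free_group inv_word_def free_reduce_rev_inv)
qed (use assms in \<open>auto simp: carrier_free_group_iff\<close>)

text \<open>Instantiated twice: for the given normal subgroup and for its derived subgroup.\<close>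

locale free_quotient =
  fixes m :: nat and N :: "word set"
  assumes normal: "N \<lhd> free_group m"
begin

sublocale N: normal N "free_group m"
  by (rule normal)

lemma letter_value_quotient:
  assumes "a \<in> letters m"
  shows "letter_value (free_group m Mod N) (quotient_gen m N) a = N #>\<^bsub>free_group m\<^esub> [a]"
proof (cases "snd a")
  case True
  then have "a = (fst a, True)" by (simp add: prod_eq_iff)
  with True show ?thesis by (simp add: letter_value_def quotient_gen_def free_gen_def)
next
  case False
  then have a: "a = (fst a, False)" "inv_word [(fst a, True)] = [a]"
    by (auto simp: prod_eq_iff inv_word_def inv_letter_def)
  have gen: "[(fst a, True)] \<in> carrier (free_group m)"
    using assms by (auto simp: carrier_free_group_iff letters_def freely_reduced_def)
  then have "N #>\<^bsub>free_group m\<^esub> [(fst a, True)] \<in> carrier (free_group m Mod N)"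
    by (auto simp: FactGroup_def RCOSETS_def)
  then show ?thesis
    using False a gen
    by (simp add: letter_value_def quotient_gen_def free_gen_def N.inv_FactGroup N.rcos_inv
        inv_free_group)
qed

lemma word_value_quotient:
  "w \<in> lists (letters m) \<Longrightarrow>
     word_value (free_group m Mod N) (quotient_gen m N) w = N #>\<^bsub>free_group m\<^esub> free_reduce w"
proof (induction w)
  case Nil
  show ?case
    using N.coset_mult_one[OF N.subset] by (simp add: word_value_def FactGroup_def one_free_group)
next
  case (Cons a w)
  then have w: "a \<in> letters m" "w \<in> lists (letters m)" by auto
  have a: "[a] \<in> carrier (free_group m)"
    using w by (auto simp: carrier_free_group_iff freely_reduced_def)
  have "word_value (free_group m Mod N) (quotient_gen m N) (a # w) =
      letter_value (free_group m Mod N) (quotient_gen m N) a \<otimes>\<^bsub>free_group m Mod N\<^esub>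
        word_value (free_group m Mod N) (quotient_gen m N) w"
    by (simp add: word_value_def)
  also have "\<dots> =
      (N #>\<^bsub>free_group m\<^esub> [a]) <#>\<^bsub>free_group m\<^esub> (N #>\<^bsub>free_group m\<^esub> free_reduce w)"
    unfolding letter_value_quotient[OF w(1)] Cons.IH[OF w(2)] by (simp add: FactGroup_def)
  also have "\<dots> = N #>\<^bsub>free_group m\<^esub> ([a] \<otimes>\<^bsub>free_group m\<^esub> free_reduce w)"
    using a w by (simp add: N.rcos_sum free_reduce_in_free_group)
  also have "[a] \<otimes>\<^bsub>free_group m\<^esub> free_reduce w = free_reduce (a # w)"
    using free_reduce_append_right[of "[a]" w] by (simp add: mult_free_group)
  finally show ?case .
qed

sublocale marked_group "free_group m Mod N" m "quotient_gen m N"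
proof -
  interpret Q: group "free_group m Mod N" by (rule N.factorgroup_is_group)
  show "marked_group (free_group m Mod N) m (quotient_gen m N)"
  proof
    fix i assume "i < m"
    then have "free_gen i \<in> carrier (free_group m)"
      by (auto simp: free_gen_def carrier_free_group_iff letters_def freely_reduced_def)
    then show "quotient_gen m N i \<in> carrier (free_group m Mod N)"
      by (auto simp: quotient_gen_def FactGroup_def RCOSETS_def)
  next
    fix g assume "g \<in> carrier (free_group m Mod N)"
    then obtain u where "u \<in> carrier (free_group m)" "g = N #>\<^bsub>free_group m\<^esub> u"
      by (auto simp: FactGroup_def RCOSETS_def)
    then show "\<exists>w \<in> lists (letters m). word_value (free_group m Mod N) (quotient_gen m N) w = g"
      by (intro bexI[of _ u]) (auto simp: word_value_quotient carrier_free_group_iff free_reduce_id)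
  qed
qed

lemma val_eq_iff:
  assumes "u \<in> words" "v \<in> words"
  shows "val u = val v \<longleftrightarrow> (\<exists>d \<in> N. free_reduce u = free_reduce (d @ v))"
proof -
  let ?F = "free_group m"
  have *: "free_reduce u \<in> carrier ?F" "free_reduce v \<in> carrier ?F"
    using assms free_reduce_in_free_group by auto
  have "val u = val v \<longleftrightarrow> N #>\<^bsub>?F\<^esub> free_reduce v = N #>\<^bsub>?F\<^esub> free_reduce u"
    using assms by (auto simp: word_value_quotient)
  also have "\<dots> \<longleftrightarrow> free_reduce u \<in> N #>\<^bsub>?F\<^esub> free_reduce v"
    using N.repr_independence N.repr_independenceD * N.is_subgroup by metis
  also have "\<dots> \<longleftrightarrow> (\<exists>d \<in> N. free_reduce u = free_reduce (d @ v))"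
    by (simp add: r_coset_def mult_free_group free_reduce_append_right)
  finally show ?thesis .
qed

lemma val_eq_one_iff:
  assumes "u \<in> words"
  shows "val u = \<one>\<^bsub>free_group m Mod N\<^esub> \<longleftrightarrow> free_reduce u \<in> N"
proof -
  have "free_reduce d = d" if "d \<in> N" for d
    using that N.subset by (auto simp: carrier_free_group_iff free_reduce_id)
  with val_eq_iff[OF assms, of "[]"] show ?thesis by auto
qed

end

context free_quotient
begin

declare one_FactGroup [simp del] mult_FactGroup [simp del]

section \<open>Flows and relators modulo the derived subgroup\<close>

abbreviation commutators :: "word set" where "commutators \<equiv> derived (free_group m) N"

interpretation D: free_quotient m commutators
  by (rule free_quotient.intro) (rule N.derived_is_normal[OF normal])

lemma commutators_subset: "commutators \<subseteq> N"
  by (rule N.derived_incl[OF subset_refl N.is_subgroup])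

lemma relator:
  assumes "u \<in> N"
  shows "u \<in> words" "freely_reduced u" "val u = \<one>\<^bsub>free_group m Mod N\<^esub>"
proof -
  show u: "u \<in> words" "freely_reduced u"
    using subsetD[OF N.subset assms] by (simp_all add: carrier_free_group_iff)
  then show "val u = \<one>\<^bsub>free_group m Mod N\<^esub>"
    using assms by (simp add: val_eq_one_iff free_reduce_id)
qed

text \<open>A relator returns to the identity, so the second word starts there as well. On
  \<open>N\<close> the flow is thus a homomorphism to the integers.\<close>

lemma flow_relator_mult:
  assumes "u \<in> N" "v \<in> words" "e \<in> Arcs"
  shows "flow \<one>\<^bsub>free_group m Mod N\<^esub> (free_reduce (u @ v)) e =
    flow \<one>\<^bsub>free_group m Mod N\<^esub> u e + flow \<one>\<^bsub>free_group m Mod N\<^esub> v e"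
  using assms relator[OF assms(1)] by (simp add: flow_free_reduce flow_append)

lemma flow_relator_inv:
  assumes "u \<in> N" "e \<in> Arcs"
  shows "flow \<one>\<^bsub>free_group m Mod N\<^esub> (inv\<^bsub>free_group m\<^esub> u) e = - flow \<one>\<^bsub>free_group m Mod N\<^esub> u e"
proof -
  have "u \<in> carrier (free_group m)" using assms N.subset by blast
  then show ?thesis
    using flow_inv_word[OF assms(2) relator(1)[OF assms(1)] one_closed] relator[OF assms(1)]
    by (simp add: inv_free_group)
qed

text \<open>A homomorphism from \<open>N\<close> to an abelian group kills the commutators, hence
  the subgroup that they generate.\<close>

lemma flow_commutators:
  assumes "d \<in> commutators" and e: "e \<in> Arcs"
  shows "flow \<one>\<^bsub>free_group m Mod N\<^esub> d e = 0"
proof -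
  let ?\<Phi> = "\<lambda>u. flow \<one>\<^bsub>free_group m Mod N\<^esub> u e"
  have mult: "?\<Phi> (u \<otimes>\<^bsub>free_group m\<^esub> v) = ?\<Phi> u + ?\<Phi> v" if "u \<in> N" "v \<in> N" for u v
    using flow_relator_mult[OF that(1) relator(1)[OF that(2)] e] by (simp add: mult_free_group)
  have comm: "?\<Phi> c = 0" if "c \<in> derived_set (free_group m) N" for c
    using that by (auto simp: mult N.m_closed N.m_inv_closed flow_relator_inv e)
  have gen: "generate (free_group m) (derived_set (free_group m) N) \<subseteq> N"
    using commutators_subset by (simp add: derived_def)
  have incl: "derived_set (free_group m) N \<subseteq> N"
    by (rule N.derived_set_incl[OF subset_refl N.is_subgroup])
  from assms(1)[unfolded derived_def] show ?thesis
  proof (induction rule: generate.induct[consumes 1, case_names one incl inv eng])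
    case one
    then show ?case by (simp add: one_free_group)
  next
    case (incl h)
    then show ?case by (simp add: comm)
  next
    case (inv h)
    then have "h \<in> N" using incl by blast
    then show ?case using comm[OF inv] by (simp add: flow_relator_inv[OF _ e])
  next
    case (eng h1 h2)
    then have "h1 \<in> N" "h2 \<in> N" using gen by blast+
    then show ?case using eng.IH by (simp add: mult)
  qed
qed

text \<open>The two words differ by a left factor in the derived subgroup, which is a relator with
  zero flow.\<close>

lemma eq_mod_commutators_imp:
  assumes "u \<in> words" "v \<in> words" "D.val u = D.val v"
  shows "val u = val v" "e \<in> Arcs \<Longrightarrow> flow \<one>\<^bsub>free_group m Mod N\<^esub> u e = flow \<one>\<^bsub>free_group m Mod N\<^esub> v e"
proof -
  obtain d where d: "d \<in> commutators" "free_reduce u = free_reduce (d @ v)"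
    using D.val_eq_iff[OF assms(1,2)] assms(3) by blast
  then have dN: "d \<in> N" using commutators_subset by blast
  then show "val u = val v" using val_eq_iff[OF assms(1,2)] d by blast
  assume e: "e \<in> Arcs"
  then show "flow \<one>\<^bsub>free_group m Mod N\<^esub> u e = flow \<one>\<^bsub>free_group m Mod N\<^esub> v e"
    using flow_free_reduce[OF one_closed e assms(1)] d flow_relator_mult[OF dN assms(2) e]
      flow_commutators[OF d(1) e] by simp
qed

lemma relators_commute:
  assumes "u \<in> words" "v \<in> words" "val u = \<one>\<^bsub>free_group m Mod N\<^esub>" "val v = \<one>\<^bsub>free_group m Mod N\<^esub>"
  shows "D.val (u @ v) = D.val (v @ u)"
proof -
  let ?F = "free_group m"
  define r s where "r = free_reduce u" and "s = free_reduce v"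
  have rs: "r \<in> N" "s \<in> N" using assms by (auto simp: r_def s_def val_eq_one_iff)
  then have rsF: "r \<in> carrier ?F" "s \<in> carrier ?F" using N.subset by auto
  \<comment> \<open>The commutator of \<open>r\<close> and \<open>s\<close>, by which
    \<open>r s\<close> and \<open>s r\<close> differ.\<close>
  let ?c = "r \<otimes>\<^bsub>?F\<^esub> s \<otimes>\<^bsub>?F\<^esub> inv\<^bsub>?F\<^esub> r \<otimes>\<^bsub>?F\<^esub> inv\<^bsub>?F\<^esub> s"
  have c: "?c \<in> commutators"
    unfolding derived_def using rs by (intro generate.incl) blast
  have "?c \<otimes>\<^bsub>?F\<^esub> (s \<otimes>\<^bsub>?F\<^esub> r) = r \<otimes>\<^bsub>?F\<^esub> s"
    using rsF by (simp add: N.m_assoc N.inv_mult_cancel_left)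
  then have "free_reduce (r @ s) = free_reduce (?c @ (s @ r))"
    by (simp add: mult_free_group free_reduce_append_right)
  moreover have "free_reduce (r @ s) = free_reduce (u @ v)" "free_reduce (?c @ (s @ r)) = free_reduce (?c @ (v @ u))"
    unfolding r_def s_def
    by (metis free_reduce_append_left free_reduce_append_right)+
  ultimately show ?thesis using c D.val_eq_iff[of "u @ v" "v @ u"] assms by auto
qed

end

section \<open>Strict dead ends\<close>

text \<open>What is used of \<open>F/R'\<close> (here \<open>Q\<close>) above \<open>F/R\<close>
  (here \<open>G\<close>): it determines values and flows in \<open>G\<close>, and relators of
  \<open>G\<close> commute in it.\<close>

locale commuting_cover = one_ended_tree_ball G m x k + Q: marked_group Q m y
  for G :: "('a, 'b) monoid_scheme" (structure) and m x k
    and Q :: "('c, 'd) monoid_scheme" and y +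
  assumes cover_val: "u \<in> words \<Longrightarrow> v \<in> words \<Longrightarrow> Q.val u = Q.val v \<Longrightarrow> val u = val v"
    and cover_flow: "u \<in> words \<Longrightarrow> v \<in> words \<Longrightarrow> Q.val u = Q.val v \<Longrightarrow> e \<in> Arcs \<Longrightarrow>
      flow \<one> u e = flow \<one> v e"
    and relators_commute: "u \<in> words \<Longrightarrow> v \<in> words \<Longrightarrow> val u = \<one> \<Longrightarrow> val v = \<one> \<Longrightarrow>
      Q.val (u @ v) = Q.val (v @ u)"
begin

text \<open>The tail of each arc is reached by a proper prefix, hence lies at depth less than
  \<open>k\<close>.\<close>

lemma inner_steps:
  assumes "u \<in> words" "length u \<le> k" "e \<in> set (steps \<one> u)"
  shows "\<not> outer k e"
proof -
  obtain u1 a u2 where u: "u = u1 @ a # u2" "e = (\<one> \<otimes> val u1, a)"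
    using steps_split[OF assms(3) one_closed assms(1)] by metis
  then have "u1 \<in> words" using assms(1) by simp
  with u assms depth_le[of u1] show ?thesis by (simp add: outer_def)
qed

lemma outer_steps:
  assumes "e \<in> set (steps g w)" "visits g w \<subseteq> far"
  shows "outer k e"
  using visits_steps[of "fst e" "snd e" g w] assms by (auto simp: outer_def far_def)

text \<open>The bounds \<open>upper\<close> and \<open>lower\<close> agree, so the length after
  \<open>i\<close> letters is exactly \<open>length Z + 2 * k - i\<close>.\<close>

theorem ex_strict_dead_end: "\<exists>g. strict_dead_end Q m y (int k) g"
proof -
  define w0 where "w0 = replicate k (0 :: nat, True)"
  have w0: "w0 \<in> words" "freely_reduced w0" "length w0 = k"
    using m_ge_2 by (auto simp: w0_def letters_def freely_reduced_def successively_conv_nth inv_letter_def)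
  obtain Z where Z: "oneway_circuit far (val w0) Z" "Z \<noteq> []"
    and sphere: "\<And>w. w \<in> words \<Longrightarrow> freely_reduced w \<Longrightarrow> length w = k \<Longrightarrow> val w \<in> visits (val w0) Z"
    using ex_oneway_circuit_through_sphere[OF w0] by metis
  have Zw: "Z \<in> words" "val w0 \<otimes> val Z = val w0" and Zfar: "visits (val w0) Z \<subseteq> far"
    and Zow: "oneway (set (steps (val w0) Z))"
    using Z(1) by (auto simp: oneway_circuit_def)
  define g0 where "g0 = w0 @ Z @ inv_word w0"
  have g0: "g0 \<in> words" using w0 Zw by (simp add: g0_def)
  have "val g0 = val w0 \<otimes> val Z \<otimes> inv (val w0)"
    using w0 Zw(1) by (simp add: g0_def val_append val_inv_word m_assoc)
  then have val_g0: "val g0 = \<one>" using w0 by (simp add: Zw(2))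
  have upper: "Q.depth (Q.val (g0 @ take i w)) \<le> length Z + k + (k - i)"
    if w: "w \<in> words" "freely_reduced w" "length w = k" for w i
  proof -
    obtain Z1 Z2 where Z12: "Z = Z1 @ Z2" "val w = val w0 \<otimes> val Z1"
      using visits_split[OF sphere[OF w] val_closed[OF w0(1)] Zw(1)] by metis
    have Zw12: "Z1 \<in> words" "Z2 \<in> words" using Zw(1) Z12(1) by auto
    define t d where "t = take i w" and "d = drop i w"
    have td: "w = t @ d" "t \<in> words" "d \<in> words"
      using w(1) by (auto simp: t_def d_def dest: in_set_takeD in_set_dropD)
    \<comment> \<open>\<open>g0\<close> equals \<open>r s\<close> in \<open>Q\<close>: go out along
      \<open>w0\<close>, leave the circuit at the end of \<open>w\<close> to return home along
      \<open>w\<close>, then resume it. Swapping these relators makes \<open>w\<close> the first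
      word and its inverse the last.\<close>
    define r s where "r = w0 @ Z1 @ inv_word w" and "s = w @ Z2 @ inv_word w0"
    have rs: "r \<in> words" "s \<in> words" using w0 w Zw12 by (auto simp: r_def s_def)
    have "val r = val w0 \<otimes> val Z1 \<otimes> inv (val w)"
      using w0 w Zw12 by (simp add: r_def val_append val_inv_word m_assoc)
    then have r1: "val r = \<one>" using w by (simp flip: Z12(2))
    have "val w \<otimes> val Z2 = val w0"
      using Zw(2) Z12 Zw12 w0 by (simp add: mult_val_append)
    moreover have "val s = val w \<otimes> val Z2 \<otimes> inv (val w0)"
      using w0 w Zw12 by (simp add: s_def val_append val_inv_word m_assoc)
    ultimately have s1: "val s = \<one>" using w0 by simp
    have "Q.val g0 = Q.val (r @ s)"
      using w0 w(1) Zw12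
      by (simp add: g0_def r_def s_def Z12(1) Q.val_append Q.val_inv_word Q.m_assoc
          Q.inv_mult_cancel_left)
    also have "\<dots> = Q.val (s @ r)" using relators_commute rs r1 s1 by simp
    finally have "Q.val (g0 @ t) = Q.val ((s @ r) @ t)"
      using g0 rs td by (simp add: Q.val_append Q.m_assoc)
    \<comment> \<open>The factor \<open>t\<close> cancels against the end of the inverse of
      \<open>w\<close>, leaving only the inverse of \<open>d\<close>, of length
      \<open>k - i\<close>.\<close>
    also have "\<dots> = Q.val (w @ Z2 @ Z1 @ inv_word d)"
      using w0 w(1) Zw12 td(2,3)
      by (simp add: r_def s_def td(1) Q.val_append Q.val_inv_word Q.inv_mult_group Q.m_assoc
          Q.inv_mult_cancel_left)
    finally have "Q.val (g0 @ t) = Q.val (w @ Z2 @ Z1 @ inv_word d)" .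
    moreover have "w @ Z2 @ Z1 @ inv_word d \<in> words" using w Zw12 td by simp
    ultimately have "Q.depth (Q.val (g0 @ t)) \<le> length (w @ Z2 @ Z1 @ inv_word d)"
      using Q.depth_le by metis
    then show ?thesis using w(3) by (simp add: t_def d_def Z12(1))
  qed
  have lower: "length Z + k + (k - i) \<le> Q.depth (Q.val (g0 @ take i w))"
    if w: "w \<in> words" "freely_reduced w" "length w = k" and i: "i \<le> k" for w i
  proof -
    define t d where "t = take i w" and "d = drop i w"
    have td: "w = t @ d" "t \<in> words"
      using w(1) by (auto simp: t_def d_def dest: in_set_takeD)
    have t_len: "length t = i" using i w(3) by (simp add: t_def)
    have t_red: "freely_reduced t"
      using w(2) unfolding td(1) by (simp add: freely_reduced_append_iff)
    have gt: "g0 @ t \<in> words" using g0 td by simp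
    obtain W where W: "W \<in> words" "length W = Q.depth (Q.val (g0 @ t))" "Q.val W = Q.val (g0 @ t)"
      by (rule Q.geodesic[OF Q.val_closed[OF gt]])
    have "val W = val t"
      using cover_val[OF W(1) gt W(3)] g0 td by (simp add: val_append val_g0)
    then have depth_W: "depth (val W) = i" using depth_reduced_word[OF td(2) t_red] t_len i by simp
    define A where "A = set (steps (val w0) Z)"
    have A_Arcs: "A \<subseteq> Arcs" unfolding A_def using w0 Zw by (intro set_steps_subset) auto
    have A_outer: "outer k e" if "e \<in> A" for e
      using outer_steps[OF _ Zfar] that by (simp add: A_def)
    \<comment> \<open>\<open>w0\<close>, its inverse and \<open>t\<close> stay off the arcs of
      \<open>\<Gamma>'\<close>, so on \<open>A\<close> the whole flow of \<open>g0 @ t\<close>, and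
      hence of \<open>W\<close>, comes from \<open>Z\<close>.\<close>
    have flow_W: "flow \<one> W e = flow (val w0) Z e" if e: "e \<in> A" for e
    proof -
      have eA: "e \<in> Arcs" "outer k e" using e A_Arcs A_outer by auto
      have w0_0: "flow \<one> w0 e = 0"
        using flow_eq_0_if_inner[OF inner_steps[OF w0(1)] eA(2,1)] w0(3) by simp
      have t_0: "flow \<one> t e = 0"
        using flow_eq_0_if_inner[OF inner_steps[OF td(2)] eA(2,1)] t_len i by simp
      have "flow (val w0) (inv_word w0) e = 0"
        using flow_inv_word[OF eA(1) w0(1) one_closed] w0(1) w0_0 by simp
      moreover have "flow \<one> (g0 @ t) e = flow \<one> g0 e + flow \<one> t e"
        using g0 td by (simp add: flow_append val_g0)
      moreover have "flow \<one> g0 e = flow \<one> w0 e + (flow (val w0) Z e + flow (val w0) (inv_word w0) e)"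
        using w0 Zw by (simp add: g0_def flow_append)
      ultimately show ?thesis
        using cover_flow[OF W(1) gt W(3) eA(1)] w0_0 t_0 by simp
    qed
    have "int (length Z) = (\<Sum>e\<in>A. flow (val w0) Z e)"
      using sum_flow_oneway[OF Zow] by (simp add: A_def)
    also have "\<dots> = (\<Sum>e\<in>A. flow \<one> W e)" by (simp add: flow_W)
    finally have len: "length Z \<le> length (filter (outer k) (steps \<one> W))"
      using sum_flow_le[of A "outer k" \<one> W] A_outer by (simp add: A_def)
    \<comment> \<open>Since \<open>Z\<close> is nonempty, \<open>W\<close> is forced to enter
      \<open>\<Gamma>'\<close>, which adds the cost of going there and coming back.\<close>
    with Z(2) have "filter (outer k) (steps \<one> W) \<noteq> []" by auto
    then obtain e where e: "e \<in> set (steps \<one> W)" "outer k e"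
      by (auto simp: filter_empty_conv)
    have "length (filter (outer k) (steps \<one> W)) + k + (k - i) \<le> length W"
      using length_ge_if_outer_step[OF W(1) e] depth_W i by simp
    with len W(2) show ?thesis by (simp add: t_def)
  qed
  have "strict_dead_end Q m y (int k) (Q.val g0)"
    unfolding strict_dead_end_def
  proof (intro conjI ballI impI allI)
    show "Q.val g0 \<in> carrier Q" using g0 by simp
    fix w i assume w: "w \<in> words" "freely_reduced w \<and> int (length w) = int k" and i: "i < length w"
    have *: "take j w \<in> words" for j using w(1) by (auto dest: in_set_takeD)
    show "Q.depth (Q.val g0 \<otimes>\<^bsub>Q\<^esub> Q.val (take (Suc i) w)) < Q.depth (Q.val g0 \<otimes>\<^bsub>Q\<^esub> Q.val (take i w))"
      \<comment> \<open>As \<open>i < k\<close>, the truncated difference \<open>k - Suc i\<close>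
        is strictly below \<open>k - i\<close>.\<close>
      using upper[of w "Suc i"] lower[of w i] w i Q.val_append[OF g0 *] by auto
  qed
  then show ?thesis ..
qed

end

section \<open>Application to the quotients of the free group\<close>

theorem theorem1:
  fixes m \<rho> :: nat and R :: "word set"
  assumes "m > 1"
    and "R \<lhd> free_group m"
    and "\<rho> > 0"
    and "has_number_of_ends (free_group m Mod R) m (quotient_gen m R) 1"
    and "\<And>w. w \<in> lists (letters m) \<Longrightarrow> w \<noteq> [] \<Longrightarrow> positive_word w \<Longrightarrow> free_reduce w \<notin> R"
    and "\<And>w. w \<in> lists (letters m) \<Longrightarrow> w \<noteq> [] \<Longrightarrow> cyclically_reduced w \<Longrightarrow>
           free_reduce w \<in> R \<Longrightarrow> \<rho> \<le> length w"
  shows "\<exists>g. strict_dead_end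
               (free_group m Mod derived (free_group m) R) m
               (quotient_gen m (derived (free_group m) R))
               (\<lfloor>real \<rho> / 2\<rfloor> - 1) g"
proof -
  interpret R: free_quotient m R by (rule free_quotient.intro) (rule assms(2))
  interpret D: free_quotient m "derived (free_group m) R"
    by (rule free_quotient.intro) (rule R.N.derived_is_normal[OF assms(2)])
  define k where "k = \<rho> div 2 - 1"
  have floor: "\<lfloor>real \<rho> / 2\<rfloor> = int (\<rho> div 2)"
    using floor_divide_of_nat_eq[of \<rho> 2] by simp
  show ?thesis
  \<comment> \<open>Here the depth is at most 0. No word has negative length and the empty word
    imposes nothing, so the identity serves.\<close>
  proof (cases "\<rho> div 2 \<le> 1")
    case True
    have "strict_dead_end (free_group m Mod derived (free_group m) R) m
        (quotient_gen m (derived (free_group m) R)) (\<lfloor>real \<rho> / 2\<rfloor> - 1)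
        \<one>\<^bsub>free_group m Mod derived (free_group m) R\<^esub>"
      unfolding strict_dead_end_def using True D.one_closed by (auto simp: floor)
    then show ?thesis ..
  next
    case False
    \<comment> \<open>Subtracting 1 after halving gives \<open>2 * k + 2 \<le> \<rho>\<close>, so
      relators of length at least \<open>\<rho>\<close> are longer than
      \<open>2 * k\<close>.\<close>
    then have k: "0 < k" "2 * k < \<rho>" "\<lfloor>real \<rho> / 2\<rfloor> - 1 = int k"
      by (auto simp: k_def floor)
    interpret commuting_cover "free_group m Mod R" m "quotient_gen m R" k
      "free_group m Mod derived (free_group m) R" "quotient_gen m (derived (free_group m) R)"
    proof unfold_locales
      show "2 \<le> m" "0 < k" using assms(1) k by auto
      show "has_number_of_ends (free_group m Mod R) m (quotient_gen m R) 1" by (rule assms(4))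
      show "R.val w \<noteq> \<one>\<^bsub>free_group m Mod R\<^esub>"
        if "w \<in> lists (letters m)" "w \<noteq> []" "positive_word w" for w
        using assms(5)[OF that] R.val_eq_one_iff[OF that(1)] by blast
      show "2 * k < length w"
        if w: "w \<in> lists (letters m)" "freely_reduced w" "w \<noteq> []"
          "R.val w = \<one>\<^bsub>free_group m Mod R\<^esub>" for w
      proof -
        have "\<rho> \<le> length w"
          using w R.val_eq_one_iff assms(6)
          by (intro R.length_reduced_relator_ge[of \<rho> w]) blast+
        with k show ?thesis by simp
      qed
    qed (fact R.eq_mod_commutators_imp R.relators_commute)+
    show ?thesis using ex_strict_dead_end k(3) by simp
  qed
qed

end
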